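(* Let $F$ be a graph. To each morphism of graphs $f:\Gamma_1\to\Gamma_2$ there is associated a group homomorphism $K_0(f):K_0(\Gamma_2,F)\to K_0(\Gamma_1,F)$ between the network $K$-theory groups such that the following functorial properties are satisfied: (1) $K_0(f\circ g)=K_0(g)\circ K_0(f)$ for all composable morphisms of graphs $g:\Gamma_1\to\Gamma_2$ and $f:\Gamma_2\to\Gamma_3$; (2) $K_0(\mathrm{id}_\Gamma)=\mathrm{id}_{K_0(\Gamma,F)}$ for every graph $\Gamma$.
   Context: Graphs are simple and undirected: $\Gamma=(V_\Gamma,E_\Gamma)$ with $E_\Gamma$ a set of unordered pairs of distinct vertices; $v\sim w$ means $\{v,w\}\in E_\Gamma$. A morphism of graphs $f:\Gamma_1\to\Gamma_2$ is a function $f:V_{\Gamma_1}\to V_{\Gamma_2}$ such that $v\sim w$ implies $f(v)\sim f(w)$ or $f(v)=f(w)$; it is surjective if it is surjective on vertices. An isomorphism of graphs is a bijection on vertices with $v\sim w$ iff $f(v)\sim f(w)$. The Cartesian product $F_1\,\square\,F_2$ has vertex set $V_{F_1}\times V_{F_2}$, with $(a,b)\sim(a',b')$ iff ($a\sim a'$ and $b=b'$) or ($a=a'$ and $b\sim b'$). $F^n$ denotes the $n$-fold iterated Cartesian product of $F$, and $F^0$ is the one-vertex graph. The neighborhood $N(v)$ of a vertex $v$ is the graph with vertices $v$ and all $w\sim v$, and edges $\{v,w\}$ for $w\sim v$. For a natural number $k$, a triple $(\widetilde\Gamma,p,\Gamma)$ with $p:\widetilde\Gamma\to\Gamma$ a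 surjective morphism of graphs is a $k$-fold covering if each $p^{-1}(v)$ has exactly $k$ vertices and, for each vertex $x$ of $\widetilde\Gamma$, $p$ restricts to an isomorphism $N(x)\to N(p(x))$. For $v\sim w$ in $\Gamma$ the covering induces a bijection $\psi_{vw}:p^{-1}(v)\to p^{-1}(w)$ sending $x$ to the unique neighbour of $x$ in $\widetilde\Gamma$ lying over $w$. Graph bundles. Let $p:X\to\Gamma$ be a surjective morphism of graphs. The fiber $p^{-1}(v)$ is the subgraph of $X$ induced on the preimage of $v$. Let $\widetilde X$ be the graph with vertex set $V_X$ whose edges are the edges $\{x,y\}$ of $X$ with $p(x)\ne p(y)$, and let $\widetilde p:\widetilde X\to\Gamma$ be the map $p$. Given a graph $F$, $(X,p,\Gamma)$ is an $F$-graph bundle if (1) each fiber $p^{-1}(v)$ is isomorphic to $F$; (2) $\widetilde p:\widetilde X\to\Gamma$ is a $|V_F|$-fold covering; (3) for all $v\sim w$ in $\Gamma$ the bijection $\psi_{vw}:p^{-1}(v)\to p^{-1}(w)$ induced by this covering is an isomorphism of graphs. Two graph bundles $(X,p,\Gamma)$, $(Y,q,\Gamma)$ over the same base are equivalent if there is an isomorphism of graphs $\Phi:X\to Y$ with $q\circ\Phi=p$. Subdirect product. $(X_1,p_1,\Gamma)\boxplus(X_2,p_2,\Gamma)=(X_1\boxplus X_2,(p_1,p_2),\Gamma)$, where $X_1\boxplus X_2$ has vertex set $\{(x,y)\in V_{X_1}\times V_{X_2}:p_1(x)=p_2(y)\}$, and $(x,y)\sim(x',y')$ iff one of: (I) $x=x'$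 and $y\sim y'$; (II) $x\sim x'$, $p_1(x)=p_1(x')$ and $y=y'$; (III) $x\sim x'$, $p_1(x)\sim p_1(x')$ and $y\sim y'$; and $(p_1,p_2)(x,y)=p_1(x)=p_2(y)$. Network $K$-theory. The equivalence classes $[X]$ of $F^n$-graph bundles $(X,p,\Gamma)$ over $\Gamma$ ($n\ge0$ arbitrary) form an abelian monoid under $[X]\boxplus[Y]=[X\boxplus Y]$, with neutral element the class of $(\Gamma,\mathrm{id},\Gamma)$. The network $K$-theory group $K_0(\Gamma,F)$ is the Grothendieck group (group completion) of this monoid. *)

theory Defs
  imports "HOL-Algebra.Group" "HOL-Library.Equipollence"
begin

section \<open>Graphs\<close>

record 'a ugraph =
  verts :: "'a set"
  edges :: "'a set set"

definition simple_graph :: "'a ugraph \<Rightarrow> bool" where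
  "simple_graph G \<longleftrightarrow> edges G \<subseteq> {{v, w} | v w. v \<in> verts G \<and> w \<in> verts G \<and> v \<noteq> w}"

definition adj :: "'a ugraph \<Rightarrow> 'a \<Rightarrow> 'a \<Rightarrow> bool" where
  "adj G v w \<longleftrightarrow> {v, w} \<in> edges G"

definition graph_morphism :: "'a ugraph \<Rightarrow> 'b ugraph \<Rightarrow> ('a \<Rightarrow> 'b) \<Rightarrow> bool" where
  "graph_morphism G H f \<longleftrightarrow>
     f ` verts G \<subseteq> verts H \<and> (\<forall>v w. adj G v w \<longrightarrow> adj H (f v) (f w) \<or> f v = f w)"

definition surj_graph_morphism :: "'a ugraph \<Rightarrow> 'b ugraph \<Rightarrow> ('a \<Rightarrow> 'b) \<Rightarrow> bool" where
  "surj_graph_morphism G H f \<longleftrightarrow> graph_morphism G H f \<and> f ` verts G = verts H"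

definition graph_iso :: "'a ugraph \<Rightarrow> 'b ugraph \<Rightarrow> ('a \<Rightarrow> 'b) \<Rightarrow> bool" where
  "graph_iso G H f \<longleftrightarrow>
     bij_betw f (verts G) (verts H) \<and>
     (\<forall>v\<in>verts G. \<forall>w\<in>verts G. adj G v w \<longleftrightarrow> adj H (f v) (f w))"

definition graphs_isomorphic :: "'a ugraph \<Rightarrow> 'b ugraph \<Rightarrow> bool" where
  "graphs_isomorphic G H \<longleftrightarrow> (\<exists>f. graph_iso G H f)"

definition induced_subgraph :: "'a ugraph \<Rightarrow> 'a set \<Rightarrow> 'a ugraph" where
  "induced_subgraph G S = \<lparr>verts = S, edges = {e \<in> edges G. e \<subseteq> S}\<rparr>"

definition map_graph :: "('a \<Rightarrow> 'b) \<Rightarrow> 'a ugraph \<Rightarrow> 'b ugraph" where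
  "map_graph h G = \<lparr>verts = h ` verts G, edges = (`) h ` edges G\<rparr>"

definition cart_prod :: "'a ugraph \<Rightarrow> 'b ugraph \<Rightarrow> ('a \<times> 'b) ugraph" where
  "cart_prod F1 F2 =
     \<lparr>verts = verts F1 \<times> verts F2,
      edges = {{(a, b), (a', b')} | a b a' b'.
        (a, b) \<in> verts F1 \<times> verts F2 \<and> (a', b') \<in> verts F1 \<times> verts F2 \<and>
        (adj F1 a a' \<and> b = b' \<or> a = a' \<and> adj F2 b b')}\<rparr>"

text \<open>The vertices of the \<open>n\<close>-fold power are the lists of length \<open>n\<close> of vertices of the
  factor, so that all powers have the same type: the step forms the Cartesian product and then
  renames the pair \<open>(a, as)\<close> to \<open>a # as\<close>.\<close>

primrec cart_power :: "'a ugraph \<Rightarrow> nat \<Rightarrow> 'a list ugraph" where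
  "cart_power F 0 = \<lparr>verts = {[]}, edges = {}\<rparr>"
| "cart_power F (Suc n) = map_graph (\<lambda>(a, as). a # as) (cart_prod F (cart_power F n))"


section \<open>Coverings and graph bundles\<close>

definition nbhd :: "'a ugraph \<Rightarrow> 'a \<Rightarrow> 'a ugraph" where
  "nbhd G v = \<lparr>verts = insert v {w. adj G v w}, edges = {{v, w} | w. adj G v w}\<rparr>"

text \<open>The number of sheets is given by a set \<open>S\<close>: the covering is \<open>card S\<close>-fold. For finite \<open>S\<close>
  this says that every fibre has exactly \<open>card S\<close> vertices (\<open>covering_finite_iff\<close> below);
  equipollence keeps the notion meaningful for infinite fibres.\<close>

definition covering :: "'s set \<Rightarrow> 'a ugraph \<Rightarrow> ('a \<Rightarrow> 'b) \<Rightarrow> 'b ugraph \<Rightarrow> bool" where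
  "covering S Y p G \<longleftrightarrow>
     surj_graph_morphism Y G p \<and>
     (\<forall>v\<in>verts G. {x \<in> verts Y. p x = v} \<approx> S) \<and>
     (\<forall>x\<in>verts Y. graph_iso (nbhd Y x) (nbhd G (p x)) p)"

text \<open>The bijection from the fibre over \<open>v\<close> to the fibre over \<open>w\<close> that a covering induces
  for adjacent \<open>v\<close> and \<open>w\<close>; the formula depends on \<open>w\<close> only.\<close>

definition covering_bij :: "'a ugraph \<Rightarrow> ('a \<Rightarrow> 'b) \<Rightarrow> 'b \<Rightarrow> 'a \<Rightarrow> 'a" where
  "covering_bij Y p w x = (THE y. y \<in> verts Y \<and> p y = w \<and> adj Y x y)"

definition fiber :: "'a ugraph \<Rightarrow> ('a \<Rightarrow> 'b) \<Rightarrow> 'b \<Rightarrow> 'a ugraph" where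
  "fiber X p v = induced_subgraph X {x \<in> verts X. p x = v}"

definition horizontal :: "'a ugraph \<Rightarrow> ('a \<Rightarrow> 'b) \<Rightarrow> 'a ugraph" where
  "horizontal X p =
     \<lparr>verts = verts X, edges = {{x, y} | x y. adj X x y \<and> p x \<noteq> p y}\<rparr>"

definition graph_bundle :: "'f ugraph \<Rightarrow> 'a ugraph \<Rightarrow> ('a \<Rightarrow> 'b) \<Rightarrow> 'b ugraph \<Rightarrow> bool" where
  "graph_bundle F X p G \<longleftrightarrow>
     simple_graph X \<and> surj_graph_morphism X G p \<and>
     (\<forall>v\<in>verts G. graphs_isomorphic (fiber X p v) F) \<and>
     covering (verts F) (horizontal X p) p G \<and>
     (\<forall>v w. adj G v w \<longrightarrow>
        graph_iso (fiber X p v) (fiber X p w) (covering_bij (horizontal X p) p w))"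

text \<open>A bundle over a fixed base is a pair of its total space and its projection. Projections
  are HOL functions, so only their values on the vertices of the total space matter.\<close>

definition bundle_equiv :: "'a ugraph \<times> ('a \<Rightarrow> 'v) \<Rightarrow> 'b ugraph \<times> ('b \<Rightarrow> 'v) \<Rightarrow> bool" where
  "bundle_equiv = (\<lambda>(X, p) (Y, q).
     \<exists>\<Phi>. graph_iso X Y \<Phi> \<and> (\<forall>x\<in>verts X. q (\<Phi> x) = p x))"

definition subdirect ::
  "'v ugraph \<Rightarrow> 'a ugraph \<times> ('a \<Rightarrow> 'v) \<Rightarrow> 'b ugraph \<times> ('b \<Rightarrow> 'v)
     \<Rightarrow> ('a \<times> 'b) ugraph \<times> ('a \<times> 'b \<Rightarrow> 'v)" where
  "subdirect G = (\<lambda>(X1, p1) (X2, p2).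
     let V = {(x, y). x \<in> verts X1 \<and> y \<in> verts X2 \<and> p1 x = p2 y} in
     (\<lparr>verts = V,
       edges = {{(x, y), (x', y')} | x y x' y'. (x, y) \<in> V \<and> (x', y') \<in> V \<and>
         (x = x' \<and> adj X2 y y' \<or>
          adj X1 x x' \<and> p1 x = p1 x' \<and> y = y' \<or>
          adj X1 x x' \<and> adj G (p1 x) (p1 x') \<and> adj X2 y y')}\<rparr>,
      \<lambda>(x, y). p1 x))"

text \<open>The pullback of a bundle \<open>(X, p)\<close> over \<open>H\<close> along a morphism \<open>f\<close> from \<open>G\<close> to \<open>H\<close>. A
  morphism may collapse an edge; over a collapsed edge the two fibres of the pullback are copies
  of one fibre of \<open>X\<close> and are joined by the identity.\<close>

definition pullback ::
  "'v ugraph \<Rightarrow> 'w ugraph \<Rightarrow> ('v \<Rightarrow> 'w) \<Rightarrow> 'a ugraph \<times> ('a \<Rightarrow> 'w)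
     \<Rightarrow> ('v \<times> 'a) ugraph \<times> ('v \<times> 'a \<Rightarrow> 'v)" where
  "pullback G H f = (\<lambda>(X, p).
     let V = {(v, x). v \<in> verts G \<and> x \<in> verts X \<and> f v = p x} in
     (\<lparr>verts = V,
       edges = {{(v, x), (v', x')} | v x v' x'. (v, x) \<in> V \<and> (v', x') \<in> V \<and>
         (v = v' \<and> adj X x x' \<or>
          adj G v v' \<and> f v = f v' \<and> x = x' \<or>
          adj G v v' \<and> adj H (f v) (f v') \<and> adj X x x')}\<rparr>,
      fst))"


section \<open>The monoid of bundle classes\<close>

text \<open>HOL has no class of all bundles over \<open>G\<close>, so equivalence classes are formed inside the
  bundles whose total space has vertices in \<open>'v \<times> 'f list\<close>. This is no restriction: every
  bundle with fibre a power of \<open>F\<close> and total space of any type is equivalent to one of these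
  (\<open>ex_bundle_representative\<close> below). \<open>bundle_class\<close> therefore takes bundles of any type.\<close>

definition bundles ::
  "'v ugraph \<Rightarrow> 'f ugraph \<Rightarrow> (('v \<times> 'f list) ugraph \<times> ('v \<times> 'f list \<Rightarrow> 'v)) set" where
  "bundles G F = {(X, p). \<exists>n. graph_bundle (cart_power F n) X p G}"

definition bundle_class ::
  "'v ugraph \<Rightarrow> 'f ugraph \<Rightarrow> 'a ugraph \<times> ('a \<Rightarrow> 'v)
     \<Rightarrow> (('v \<times> 'f list) ugraph \<times> ('v \<times> 'f list \<Rightarrow> 'v)) set" where
  "bundle_class G F B = {C \<in> bundles G F. bundle_equiv B C}"

definition bundle_monoid ::
  "'v ugraph \<Rightarrow> 'f ugraph \<Rightarrow> (('v \<times> 'f list) ugraph \<times> ('v \<times> 'f list \<Rightarrow> 'v)) set monoid" where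
  "bundle_monoid G F =
     \<lparr>carrier = bundle_class G F ` bundles G F,
      mult = (\<lambda>c d. \<Union>B\<in>c. \<Union>C\<in>d. bundle_class G F (subdirect G B C)),
      one = bundle_class G F (G, id)\<rparr>"


section \<open>Group completion\<close>

definition groth_rel :: "('a, 'm) monoid_scheme \<Rightarrow> (('a \<times> 'a) \<times> ('a \<times> 'a)) set" where
  "groth_rel M = {((a, b), (c, d)).
     a \<in> carrier M \<and> b \<in> carrier M \<and> c \<in> carrier M \<and> d \<in> carrier M \<and>
     (\<exists>k\<in>carrier M. (a \<otimes>\<^bsub>M\<^esub> d) \<otimes>\<^bsub>M\<^esub> k = (c \<otimes>\<^bsub>M\<^esub> b) \<otimes>\<^bsub>M\<^esub> k)}"

definition groth_class :: "('a, 'm) monoid_scheme \<Rightarrow> 'a \<Rightarrow> 'a \<Rightarrow> ('a \<times> 'a) set" where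
  "groth_class M a b = groth_rel M `` {(a, b)}"

definition grothendieck_group :: "('a, 'm) monoid_scheme \<Rightarrow> ('a \<times> 'a) set monoid" where
  "grothendieck_group M =
     \<lparr>carrier = (carrier M \<times> carrier M) // groth_rel M,
      mult = (\<lambda>P Q. \<Union>(a, b)\<in>P. \<Union>(c, d)\<in>Q. groth_class M (a \<otimes>\<^bsub>M\<^esub> c) (b \<otimes>\<^bsub>M\<^esub> d)),
      one = groth_class M \<one>\<^bsub>M\<^esub> \<one>\<^bsub>M\<^esub>\<rparr>"


section \<open>Network K-theory\<close>

definition K0 ::
  "'v ugraph \<Rightarrow> 'f ugraph \<Rightarrow>
     ((('v \<times> 'f list) ugraph \<times> ('v \<times> 'f list \<Rightarrow> 'v)) set \<times>
      (('v \<times> 'f list) ugraph \<times> ('v \<times> 'f list \<Rightarrow> 'v)) set) set monoid" where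
  "K0 G F = grothendieck_group (bundle_monoid G F)"

definition pullback_class ::
  "'f ugraph \<Rightarrow> 'v ugraph \<Rightarrow> 'w ugraph \<Rightarrow> ('v \<Rightarrow> 'w)
     \<Rightarrow> (('w \<times> 'f list) ugraph \<times> ('w \<times> 'f list \<Rightarrow> 'w)) set
     \<Rightarrow> (('v \<times> 'f list) ugraph \<times> ('v \<times> 'f list \<Rightarrow> 'v)) set" where
  "pullback_class F G H f c = (\<Union>B\<in>c. bundle_class G F (pullback G H f B))"

text \<open>The map from \<open>K0 H F\<close> to \<open>K0 G F\<close> induced by \<open>f\<close> from \<open>G\<close> to \<open>H\<close>, which sends
  \<open>[X] - [Y]\<close> to \<open>[f\<^sup>*X] - [f\<^sup>*Y]\<close>.\<close>

definition K0_map ::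
  "'f ugraph \<Rightarrow> 'v ugraph \<Rightarrow> 'w ugraph \<Rightarrow> ('v \<Rightarrow> 'w)
     \<Rightarrow> ((('w \<times> 'f list) ugraph \<times> ('w \<times> 'f list \<Rightarrow> 'w)) set \<times>
         (('w \<times> 'f list) ugraph \<times> ('w \<times> 'f list \<Rightarrow> 'w)) set) set
     \<Rightarrow> ((('v \<times> 'f list) ugraph \<times> ('v \<times> 'f list \<Rightarrow> 'v)) set \<times>
         (('v \<times> 'f list) ugraph \<times> ('v \<times> 'f list \<Rightarrow> 'v)) set) set" where
  "K0_map F G H f P =
     (\<Union>(c, d)\<in>P. groth_class (bundle_monoid G F)
        (pullback_class F G H f c) (pullback_class F G H f d))"


section \<open>Representatives of bundles\<close>

lemma covering_finite_iff:
  assumes "finite S" "S \<noteq> {}"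
  shows "covering S Y p G \<longleftrightarrow>
    surj_graph_morphism Y G p \<and>
    (\<forall>v\<in>verts G. card {x \<in> verts Y. p x = v} = card S) \<and>
    (\<forall>x\<in>verts Y. graph_iso (nbhd Y x) (nbhd G (p x)) p)"
proof -
  have "A \<approx> S \<longleftrightarrow> card A = card S" for A :: "'b set"
    using assms by (metis card_eq_0_iff eqpoll_finite_iff eqpoll_iff_card)
  then show ?thesis unfolding covering_def by simp
qed

lemma adj_sym: "adj G x y \<longleftrightarrow> adj G y x"
  by (simp add: adj_def insert_commute)

lemma adj_verts:
  assumes "simple_graph G" "adj G x y"
  shows "x \<in> verts G" "y \<in> verts G" "x \<noteq> y"
  using assms by (auto simp: simple_graph_def adj_def doubleton_eq_iff dest!: subsetD)

lemma adj_horizontal: "adj (horizontal X p) x y \<longleftrightarrow> adj X x y \<and> p x \<noteq> p y"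
  by (auto simp: horizontal_def adj_def doubleton_eq_iff insert_commute)

lemma verts_horizontal [simp]: "verts (horizontal X p) = verts X"
  by (simp add: horizontal_def)

lemma adj_fiber:
  "adj (fiber X p v) x y \<longleftrightarrow> adj X x y \<and> x \<in> verts X \<and> y \<in> verts X \<and> p x = v \<and> p y = v"
  by (auto simp: fiber_def induced_subgraph_def adj_def)

lemma verts_fiber [simp]: "verts (fiber X p v) = {x \<in> verts X. p x = v}"
  by (simp add: fiber_def induced_subgraph_def)

lemma verts_nbhd [simp]: "verts (nbhd G v) = insert v {w. adj G v w}"
  by (simp add: nbhd_def)

lemma adj_nbhd: "adj (nbhd G v) x y \<longleftrightarrow> (x = v \<or> y = v) \<and> adj G x y"
  by (auto simp: nbhd_def adj_def doubleton_eq_iff insert_commute)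

lemma graph_iso_sym:
  assumes "graph_iso G H f"
  shows "graph_iso H G (inv_into (verts G) f)"
proof -
  have bij: "bij_betw f (verts G) (verts H)" using assms by (simp add: graph_iso_def)
  then have "inv_into (verts G) f v \<in> verts G" "f (inv_into (verts G) f v) = v"
    if "v \<in> verts H" for v
    using that by (auto simp: bij_betw_inv_into_right bij_betw_def inv_into_into)
  then show ?thesis
    using assms bij_betw_inv_into[OF bij] unfolding graph_iso_def by auto
qed

lemma graph_iso_trans:
  assumes "graph_iso G H f" "graph_iso H K g"
  shows "graph_iso G K (g \<circ> f)"
  using assms unfolding graph_iso_def
  by (auto intro: bij_betw_trans simp: bij_betw_apply)

lemma graph_iso_cong:
  assumes "graph_iso G H f" "\<And>x. x \<in> verts G \<Longrightarrow> f x = g x"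
  shows "graph_iso G H g"
  using assms bij_betw_cong[of "verts G" f g "verts H"] unfolding graph_iso_def by auto

text \<open>Graph bundles are invariant under equivalence.\<close>

lemma graph_bundle_equiv:
  assumes X: "graph_bundle F X p G" and Y: "simple_graph Y"
    and iso: "graph_iso X Y h" and q: "\<And>x. x \<in> verts X \<Longrightarrow> q (h x) = p x"
  shows "graph_bundle F Y q G"
proof -
  let ?X = "horizontal X p" and ?Y = "horizontal Y q"
  have sX: "simple_graph X" and cov: "covering (verts F) ?X p G"
    using X by (auto simp: graph_bundle_def)
  have bij: "bij_betw h (verts X) (verts Y)" using iso by (simp add: graph_iso_def)
  have hV: "h ` verts X = verts Y" and inj: "inj_on h (verts X)"
    using bij by (auto simp: bij_betw_def)
  have hadj: "adj Y (h x) (h y) \<longleftrightarrow> adj X x y" if "x \<in> verts X" "y \<in> verts X" for x y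
    using iso that by (simp add: graph_iso_def)
  have hadj': "adj ?Y (h x) (h y) \<longleftrightarrow> adj ?X x y" if "x \<in> verts X" "y \<in> verts X" for x y
    using that by (simp add: adj_horizontal hadj q)
  have smX: "surj_graph_morphism X G p" using X by (simp add: graph_bundle_def)
  have transfer: "surj_graph_morphism Y' G q"
    if sm': "surj_graph_morphism X' G p" and V: "verts X' = verts X" "verts Y' = verts Y"
      and A: "\<And>x y. x \<in> verts X \<Longrightarrow> y \<in> verts X \<Longrightarrow> adj Y' (h x) (h y) \<longleftrightarrow> adj X' x y"
      and Y': "\<And>x y. adj Y' x y \<Longrightarrow> x \<in> verts Y \<and> y \<in> verts Y" for X' Y'
  proof -
    have im: "q ` verts Y = p ` verts X"
      unfolding hV[symmetric] image_image using q by (rule image_cong[OF refl])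
    have "adj G (q a) (q b) \<or> q a = q b" if ab: "adj Y' a b" for a b
    proof -
      obtain x y where "x \<in> verts X" "y \<in> verts X" "a = h x" "b = h y"
        using Y'[OF ab] hV by (metis imageE)
      then show ?thesis
        using ab A q sm' by (auto simp: graph_morphism_def surj_graph_morphism_def)
    qed
    then show ?thesis
      using sm' V im by (auto simp: surj_graph_morphism_def graph_morphism_def)
  qed
  have smY: "surj_graph_morphism Y G q"
    by (rule transfer[OF smX refl refl hadj]) (use adj_verts[OF Y] in auto)
  have smY': "surj_graph_morphism ?Y G q"
    by (rule transfer[of ?X])
      (use cov hadj' adj_verts[OF Y] in \<open>auto simp: covering_def adj_horizontal\<close>)
  have fib_img: "h ` {x \<in> verts X. p x = v} = {y \<in> verts Y. q y = v}" for v
    using hV q by force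
  have fib_iso: "graph_iso (fiber X p v) (fiber Y q v) h" for v
    unfolding graph_iso_def bij_betw_def
    using inj_on_subset[OF inj, of "{x \<in> verts X. p x = v}"] fib_img[of v]
    by (auto simp: adj_fiber hadj q bij_betw_apply[OF bij])
  have 1: "graphs_isomorphic (fiber Y q v) F" if "v \<in> verts G" for v
    using X that graph_iso_sym[OF fib_iso] graph_iso_trans
    unfolding graph_bundle_def graphs_isomorphic_def by blast
  have 2: "{y \<in> verts ?Y. q y = v} \<approx> verts F" if "v \<in> verts G" for v
  proof -
    have "{x \<in> verts X. p x = v} \<approx> {y \<in> verts Y. q y = v}"
      using fib_iso[of v] by (auto simp: graph_iso_def eqpoll_def)
    moreover have "{x \<in> verts X. p x = v} \<approx> verts F"
      using cov that by (simp add: covering_def)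
    ultimately show ?thesis using eqpoll_trans[OF eqpoll_sym] by simp
  qed
  have nb: "graph_iso (nbhd ?X x) (nbhd ?Y (h x)) h" if x: "x \<in> verts X" for x
  proof -
    have sub: "insert x {w. adj ?X x w} \<subseteq> verts X"
      using x adj_verts[OF sX] by (auto simp: adj_horizontal)
    have "h ` {w. adj ?X x w} = {w. adj ?Y (h x) w}"
    proof (intro equalityI subsetI)
      fix b assume "b \<in> {w. adj ?Y (h x) w}"
      then have b: "adj ?Y (h x) b" by simp
      then have "b \<in> verts Y" using adj_verts[OF Y] by (auto simp: adj_horizontal)
      then obtain w where "w \<in> verts X" "b = h w" using hV by auto
      then show "b \<in> h ` {w. adj ?X x w}" using b hadj' x by auto
    qed (use hadj' x sub in auto)
    then show ?thesis
      unfolding graph_iso_def bij_betw_def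
      using inj_on_subset[OF inj sub] sub x inj
      by (auto simp: adj_nbhd hadj' subset_iff inj_on_eq_iff)
  qed
  have 3: "graph_iso (nbhd ?Y y) (nbhd G (q y)) q" if y: "y \<in> verts Y" for y
  proof -
    obtain x where x: "x \<in> verts X" "y = h x" using y unfolding hV[symmetric] by blast
    have sub: "verts (nbhd ?X x) \<subseteq> verts X"
      using x adj_verts[OF sX] by (auto simp: adj_horizontal)
    have "graph_iso (nbhd ?X x) (nbhd G (p x)) p"
      using cov x by (simp add: covering_def)
    from graph_iso_trans[OF graph_iso_sym[OF nb[OF x(1)]] this]
    have "graph_iso (nbhd ?Y y) (nbhd G (q y)) (p \<circ> inv_into (verts (nbhd ?X x)) h)"
      using x q by simp
    then show ?thesis
    proof (rule graph_iso_cong)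
      fix b assume b: "b \<in> verts (nbhd ?Y y)"
      have "h ` verts (nbhd ?X x) = verts (nbhd ?Y y)"
        using nb[OF x(1)] x(2) by (simp add: graph_iso_def bij_betw_def)
      then have "inv_into (verts (nbhd ?X x)) h b \<in> verts X"
        "h (inv_into (verts (nbhd ?X x)) h b) = b"
        using b sub inv_into_into[of b h "verts (nbhd ?X x)"] f_inv_into_f[of b h "verts (nbhd ?X x)"]
        by (auto simp del: verts_nbhd)
      then show "(p \<circ> inv_into (verts (nbhd ?X x)) h) b = q b" using q by force
    qed
  qed
  have 4: "graph_iso (fiber Y q v) (fiber Y q w) (covering_bij ?Y q w)" if vw: "adj G v w" for v w
  proof -
    let ?h' = "inv_into (verts (fiber X p v)) h"
    have "graph_iso (fiber X p v) (fiber X p w) (covering_bij ?X p w)"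
      using X vw by (simp add: graph_bundle_def)
    from graph_iso_trans[OF graph_iso_sym[OF fib_iso[of v]] graph_iso_trans[OF this fib_iso[of w]]]
    have "graph_iso (fiber Y q v) (fiber Y q w) (h \<circ> covering_bij ?X p w \<circ> ?h')" .
    then show ?thesis
    proof (rule graph_iso_cong)
      fix b assume b: "b \<in> verts (fiber Y q v)"
      define x where "x = ?h' b"
      have "b \<in> h ` verts (fiber X p v)" using b fib_img[of v] by simp
      then have xb: "x \<in> verts X" "p x = v" "h x = b"
        using inv_into_into[of b h "verts (fiber X p v)"] f_inv_into_f[of b h "verts (fiber X p v)"]
        unfolding x_def by auto
      have star: "graph_iso (nbhd ?X x) (nbhd G v) p"
        using cov xb unfolding covering_def by auto
      then have nx: "bij_betw p (insert x {z. adj ?X x z}) (insert v {z. adj G v z})"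
        by (simp add: graph_iso_def)
      have "\<exists>z. z \<in> verts X \<and> p z = w \<and> adj ?X x z"
      proof -
        have "w \<in> p ` insert x {z. adj ?X x z}" using nx vw by (auto simp: bij_betw_def)
        then obtain z where z: "z = x \<or> adj ?X x z" "p z = w" by auto
        show ?thesis
        proof (cases "z = x")
          case True
          then have "adj (nbhd G v) (p x) (p x)" using z xb vw by (simp add: adj_nbhd)
          then have "adj (nbhd ?X x) x x" using star by (simp add: graph_iso_def)
          then show ?thesis by (simp add: adj_nbhd adj_horizontal)
        next
          case False
          then have "adj ?X x z" using z by simp
          moreover from this have "z \<in> verts X"
            unfolding adj_horizontal by (blast intro: adj_verts(2)[OF sX])
          ultimately show ?thesis using z by blast
        qed
      qed
      then obtain z where z: "z \<in> verts X" "p z = w" "adj ?X x z" by blast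
      have uniq: "z' = z" if "adj ?X x z'" "p z' = w" for z'
        using nx z that by (auto simp: bij_betw_def inj_on_def)
      have "covering_bij ?X p w x = z"
        unfolding covering_bij_def
      proof (rule the_equality)
        show "z \<in> verts ?X \<and> p z = w \<and> adj ?X x z" using z by simp
        fix c assume "c \<in> verts ?X \<and> p c = w \<and> adj ?X x c"
        then show "c = z" by (elim conjE) (rule uniq)
      qed
      moreover have "covering_bij ?Y q w b = h z"
        unfolding covering_bij_def
      proof (rule the_equality)
        show "h z \<in> verts ?Y \<and> q (h z) = w \<and> adj ?Y b (h z)"
          using z xb hadj' q hV by auto
        fix c assume c: "c \<in> verts ?Y \<and> q c = w \<and> adj ?Y b c"
        then have "c \<in> h ` verts X" using hV by simp
        then obtain z' where "z' \<in> verts X" "c = h z'" by blast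
        then have "adj ?X x z'" "p z' = w"
          using c xb hadj'[of x z'] q by auto
        from uniq[OF this] show "c = h z" using \<open>c = h z'\<close> by simp
      qed
      ultimately show "(h \<circ> covering_bij ?X p w \<circ> ?h') b = covering_bij ?Y q w b"
        by (simp add: x_def)
    qed
  qed
  show ?thesis
    unfolding graph_bundle_def covering_def using Y smY smY' 1 2 3 4 by auto
qed

lemma graph_iso_map_graph:
  assumes "simple_graph X" "inj_on h (verts X)"
  shows "graph_iso X (map_graph h X) h" "simple_graph (map_graph h X)"
proof -
  have e: "e \<subseteq> verts X" if "e \<in> edges X" for e
    using that assms(1) by (auto simp: simple_graph_def)
  have "adj X x y" if xy: "x \<in> verts X" "y \<in> verts X" and a: "adj (map_graph h X) (h x) (h y)" for x y
  proof -
    obtain e where e': "e \<in> edges X" "h ` {x, y} = h ` e"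
      using a by (auto simp: adj_def map_graph_def)
    then have "{x, y} = e"
      using inj_on_image_eq_iff[OF assms(2), of "{x, y}" e] xy e[OF e'(1)] by simp
    then show ?thesis using e' by (simp add: adj_def)
  qed
  moreover have "adj (map_graph h X) (h x) (h y)" if "adj X x y" for x y
    using that unfolding adj_def map_graph_def by (auto intro!: image_eqI[of _ _ "{x, y}"])
  ultimately show "graph_iso X (map_graph h X) h"
    using assms(2) by (auto simp: graph_iso_def bij_betw_def map_graph_def)
  show "simple_graph (map_graph h X)"
    unfolding simple_graph_def
  proof
    fix e assume "e \<in> edges (map_graph h X)"
    then obtain e' where e': "e' \<in> edges X" "e = h ` e'" by (auto simp: map_graph_def)
    then obtain v w where "e' = {v, w}" "v \<in> verts X" "w \<in> verts X" "v \<noteq> w"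
      using assms(1) by (auto simp: simple_graph_def)
    then have "e = {h v, h w}" "h v \<in> verts (map_graph h X)" "h w \<in> verts (map_graph h X)" "h v \<noteq> h w"
      using e' assms(2) by (auto simp: map_graph_def inj_on_eq_iff)
    then show "e \<in> {{v, w} |v w. v \<in> verts (map_graph h X) \<and> w \<in> verts (map_graph h X) \<and> v \<noteq> w}"
      by blast
  qed
qed

lemma ex_bundle_representative:
  fixes X :: "'a ugraph" and F :: "'f ugraph" and G :: "'v ugraph"
  assumes X: "graph_bundle (cart_power F n) X p G"
  shows "\<exists>B \<in> bundles G F. bundle_equiv (X, p) B"
proof -
  have pV: "p x \<in> verts G" if "x \<in> verts X" for x
    using X that by (auto simp: graph_bundle_def surj_graph_morphism_def)
  have "\<forall>v\<in>verts G. \<exists>k. graph_iso (fiber X p v) (cart_power F n) k"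
    using X by (simp add: graph_bundle_def graphs_isomorphic_def)
  then obtain k where k: "\<And>v. v \<in> verts G \<Longrightarrow> graph_iso (fiber X p v) (cart_power F n) (k v)"
    by metis
  define h where "h = (\<lambda>x. (p x, k (p x) x))"
  have inj: "inj_on h (verts X)"
  proof (rule inj_onI)
    fix x y assume xy: "x \<in> verts X" "y \<in> verts X" "h x = h y"
    then have "p x = p y" "k (p x) x = k (p x) y" by (auto simp: h_def)
    moreover have "inj_on (k (p x)) (verts (fiber X p (p x)))"
      using k[OF pV[OF xy(1)]] by (simp add: graph_iso_def bij_betw_def)
    ultimately show "x = y" using xy by (simp add: inj_on_def)
  qed
  have sX: "simple_graph X" using X by (simp add: graph_bundle_def)
  note iso = graph_iso_map_graph[OF sX inj]
  have "graph_bundle (cart_power F n) (map_graph h X) fst G"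
    by (rule graph_bundle_equiv[OF X iso(2,1)]) (simp add: h_def)
  then have "(map_graph h X, fst) \<in> bundles G F" by (auto simp: bundles_def)
  moreover have "bundle_equiv (X, p) (map_graph h X, fst)"
    using iso(1) by (auto simp: bundle_equiv_def h_def)
  ultimately show ?thesis by blast
qed

end

theory Submission
  imports Defs
begin

text \<open>A graph bundle over a simple graph amounts to a map with fibres isomorphic to the given graph
  and unique lifting of edges, such that lifts of an edge starting at adjacent points of a fibre end
  at adjacent points. In this form bundles are stable under subdirect products, where
  \<open>F\<^sup>m \<box> F\<^sup>n\<close> is \<open>F\<^sup>m\<^sup>+\<^sup>n\<close> by concatenation, and under pullback, where over a collapsed edge the lifts
  keep the point of the fibre. The canonical bijections of total spaces make pullback compatible
  with subdirect products, composition and identities up to equivalence. So it is a functor to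
  commutative monoids, and group completion is functorial.\<close>

section \<open>Group completion\<close>

text \<open>Products of classes, pullbacks of classes and maps between group completions are all
  defined as unions over representatives. No definition guarantees that the representative is
  irrelevant, so each operation is computed by showing that it is a union of equal sets over a
  nonempty index set. Equality comes from invariance under equivalence. Nonemptiness is an issue of
  types: classes consist of bundles whose total spaces have vertices in
  \<open>'v \<times> 'f list\<close>, while subdirect products and pullbacks leave this type, so a
  representative in it has to be found again by identifying fibres with powers of \<open>F\<close>.
  Adjacency in a subdirect product or a pullback is a disjunction of three clauses. Simple graphs
  have no loops, so the images of the endpoints in the bases restrict which clause can apply; the
  case distinctions exploit this. In the pullback the clause for collapsed edges is forced: without
  it, such an edge would have no lift at all and the covering condition would fail.\<close>

lemma groth_rel_iff:
  "((a, b), (c, d)) \<in> groth_rel M \<longleftrightarrow>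
     a \<in> carrier M \<and> b \<in> carrier M \<and> c \<in> carrier M \<and> d \<in> carrier M \<and>
     (\<exists>k\<in>carrier M. (a \<otimes>\<^bsub>M\<^esub> d) \<otimes>\<^bsub>M\<^esub> k = (c \<otimes>\<^bsub>M\<^esub> b) \<otimes>\<^bsub>M\<^esub> k)"
  by (simp add: groth_rel_def)

context comm_monoid
begin

lemma equiv_groth_rel: "equiv (carrier G \<times> carrier G) (groth_rel G)"
proof (rule equivI)
  show "groth_rel G \<subseteq> (carrier G \<times> carrier G) \<times> (carrier G \<times> carrier G)"
    by (auto simp: groth_rel_def)
  show "refl_on (carrier G \<times> carrier G) (groth_rel G)"
    by (auto simp: refl_on_def groth_rel_def)
  show "sym (groth_rel G)"
    by (auto simp: sym_def groth_rel_def eq_commute)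
  show "trans (groth_rel G)"
  proof (rule transI, clarify)
    fix a b c d e f
    assume "((a, b), (c, d)) \<in> groth_rel G" "((c, d), (e, f)) \<in> groth_rel G"
    then obtain k l where C: "a \<in> carrier G" "b \<in> carrier G" "c \<in> carrier G" "d \<in> carrier G"
      "e \<in> carrier G" "f \<in> carrier G" "k \<in> carrier G" "l \<in> carrier G"
      and k: "(a \<otimes> d) \<otimes> k = (c \<otimes> b) \<otimes> k" and l: "(c \<otimes> f) \<otimes> l = (e \<otimes> d) \<otimes> l"
      unfolding groth_rel_iff by blast
    \<comment> \<open>The first relation is multiplied by \<open>f \<otimes> l\<close> and the
      second by \<open>b \<otimes> k\<close>. The common factor \<open>d\<close> cannot be
      cancelled, so it joins \<open>k\<close> and \<open>l\<close> in the witness; this is why the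
      relation carries a slack element.\<close>
    have "(a \<otimes> f) \<otimes> (d \<otimes> k \<otimes> l) = ((a \<otimes> d) \<otimes> k) \<otimes> (f \<otimes> l)"
      using C by (simp add: m_ac)
    also have "\<dots> = ((c \<otimes> f) \<otimes> l) \<otimes> (b \<otimes> k)"
      using C by (simp add: k) (simp add: m_ac)
    also have "\<dots> = (e \<otimes> b) \<otimes> (d \<otimes> k \<otimes> l)"
      using C by (simp add: l) (simp add: m_ac)
    finally show "((a, b), (e, f)) \<in> groth_rel G"
      using C by (auto simp: groth_rel_iff intro!: bexI[of _ "d \<otimes> k \<otimes> l"])
  qed
qed

lemma groth_class_eq_iff:
  assumes "a \<in> carrier G" "b \<in> carrier G" "c \<in> carrier G" "d \<in> carrier G"
  shows "groth_class G a b = groth_class G c d \<longleftrightarrow>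
    (\<exists>k\<in>carrier G. (a \<otimes> d) \<otimes> k = (c \<otimes> b) \<otimes> k)"
  unfolding groth_class_def
  using eq_equiv_class_iff[OF equiv_groth_rel, of "(a, b)" "(c, d)"] assms
  by (simp add: groth_rel_iff)

lemma groth_class_self:
  assumes "a \<in> carrier G" "b \<in> carrier G"
  shows "(a, b) \<in> groth_class G a b"
  using equiv_class_self[OF equiv_groth_rel, of "(a, b)"] assms by (simp add: groth_class_def)

lemma mem_groth_class:
  assumes "(c, d) \<in> groth_class G a b"
  shows "c \<in> carrier G" "d \<in> carrier G" "groth_class G c d = groth_class G a b"
  using assms equiv_class_eq[OF equiv_groth_rel, of "(a, b)" "(c, d)"]
  by (auto simp: groth_class_def groth_rel_iff)

lemma carrier_grothendieck_group:
  "carrier (grothendieck_group G) = {groth_class G a b | a b. a \<in> carrier G \<and> b \<in> carrier G}"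
  by (auto simp: grothendieck_group_def quotient_def groth_class_def)

lemma groth_class_in_carrier:
  "a \<in> carrier G \<Longrightarrow> b \<in> carrier G \<Longrightarrow> groth_class G a b \<in> carrier (grothendieck_group G)"
  by (auto simp: carrier_grothendieck_group)

lemma grothendieck_group_cases:
  assumes "x \<in> carrier (grothendieck_group G)"
  obtains a b where "a \<in> carrier G" "b \<in> carrier G" "x = groth_class G a b"
  using assms by (auto simp: carrier_grothendieck_group)

text \<open>Evaluates a map defined as a union over a class: the class contains
  \<open>(a, b)\<close>, and the last hypothesis, independence of the representative, makes the
  family of sets constant.\<close>

lemma UN_groth_class:
  assumes "a \<in> carrier G" "b \<in> carrier G"
    and "\<And>c d. c \<in> carrier G \<Longrightarrow> d \<in> carrier G \<Longrightarrow> groth_class G c d = groth_class G a b \<Longrightarrow>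
      \<phi> c d = \<phi> a b"
  shows "(\<Union>(c, d)\<in>groth_class G a b. \<phi> c d) = \<phi> a b"
proof -
  have "groth_class G a b \<noteq> {}" using groth_class_self[OF assms(1,2)] by auto
  then show ?thesis
    using assms(3) mem_groth_class by (intro SUP_eq_const) (auto split: prod.splits)
qed

lemma groth_class_mult_cong:
  assumes C: "a \<in> carrier G" "b \<in> carrier G" "a' \<in> carrier G" "b' \<in> carrier G"
      "c \<in> carrier G" "d \<in> carrier G" "c' \<in> carrier G" "d' \<in> carrier G"
    and "groth_class G a b = groth_class G a' b'" "groth_class G c d = groth_class G c' d'"
  shows "groth_class G (a \<otimes> c) (b \<otimes> d) = groth_class G (a' \<otimes> c') (b' \<otimes> d')"
proof -
  obtain k l where kl: "k \<in> carrier G" "l \<in> carrier G"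
    and k: "(a \<otimes> b') \<otimes> k = (a' \<otimes> b) \<otimes> k" and l: "(c \<otimes> d') \<otimes> l = (c' \<otimes> d) \<otimes> l"
    using assms by (auto simp: groth_class_eq_iff)
  have "((a \<otimes> c) \<otimes> (b' \<otimes> d')) \<otimes> (k \<otimes> l) = ((a \<otimes> b') \<otimes> k) \<otimes> ((c \<otimes> d') \<otimes> l)"
    using C kl by (simp add: m_ac)
  also have "\<dots> = ((a' \<otimes> c') \<otimes> (b \<otimes> d)) \<otimes> (k \<otimes> l)"
    unfolding k l using C kl by (simp add: m_ac)
  finally show ?thesis
    using C kl by (auto simp: groth_class_eq_iff intro!: bexI[of _ "k \<otimes> l"])
qed

lemma mult_groth_class:
  assumes "a \<in> carrier G" "b \<in> carrier G" "c \<in> carrier G" "d \<in> carrier G"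
  shows "groth_class G a b \<otimes>\<^bsub>grothendieck_group G\<^esub> groth_class G c d =
    groth_class G (a \<otimes> c) (b \<otimes> d)"
proof -
  \<comment> \<open>The double union is collapsed one factor at a time: first the second factor, for
    a fixed representative of the first, and then the first.\<close>
  have inner: "(\<Union>(c', d')\<in>groth_class G c d. groth_class G (a' \<otimes> c') (b' \<otimes> d')) =
      groth_class G (a' \<otimes> c) (b' \<otimes> d)" if "a' \<in> carrier G" "b' \<in> carrier G" for a' b'
    using assms that by (intro UN_groth_class groth_class_mult_cong) auto
  have "(\<Union>(a', b')\<in>groth_class G a b.
      \<Union>(c', d')\<in>groth_class G c d. groth_class G (a' \<otimes> c') (b' \<otimes> d')) =
    (\<Union>(a', b')\<in>groth_class G a b. groth_class G (a' \<otimes> c) (b' \<otimes> d))"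
  proof (intro SUP_cong refl)
    fix P assume P: "P \<in> groth_class G a b"
    obtain a' b' where [simp]: "P = (a', b')" by (cases P)
    then have "a' \<in> carrier G" "b' \<in> carrier G" using P mem_groth_class by auto
    then show "(case P of (a', b') \<Rightarrow>
        \<Union>(c', d')\<in>groth_class G c d. groth_class G (a' \<otimes> c') (b' \<otimes> d')) =
      (case P of (a', b') \<Rightarrow> groth_class G (a' \<otimes> c) (b' \<otimes> d))"
      by (simp only: prod.case inner \<open>P = (a', b')\<close>)
  qed
  moreover have "\<dots> = groth_class G (a \<otimes> c) (b \<otimes> d)"
    using assms by (intro UN_groth_class groth_class_mult_cong) auto
  ultimately show ?thesis by (simp add: grothendieck_group_def)
qed

lemma one_grothendieck_group: "\<one>\<^bsub>grothendieck_group G\<^esub> = groth_class G \<one> \<one>"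
  by (simp add: grothendieck_group_def)

lemma comm_group_grothendieck_group: "comm_group (grothendieck_group G)"
proof (rule comm_groupI)
  fix x assume "x \<in> carrier (grothendieck_group G)"
  then obtain a b where x: "a \<in> carrier G" "b \<in> carrier G" "x = groth_class G a b"
    by (rule grothendieck_group_cases)
  \<comment> \<open>Swapping the pair gives the inverse: the product is the class of
    \<open>(b \<otimes> a, a \<otimes> b)\<close>, which commutativity makes diagonal and hence
    trivial.\<close>
  then have "groth_class G b a \<otimes>\<^bsub>grothendieck_group G\<^esub> x = \<one>\<^bsub>grothendieck_group G\<^esub>"
    by (auto simp: mult_groth_class one_grothendieck_group groth_class_eq_iff m_comm)
  with x show "\<exists>y\<in>carrier (grothendieck_group G).
      y \<otimes>\<^bsub>grothendieck_group G\<^esub> x = \<one>\<^bsub>grothendieck_group G\<^esub>"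
    by (auto intro: groth_class_in_carrier)
qed (auto elim!: grothendieck_group_cases simp: mult_groth_class one_grothendieck_group m_ac
    intro!: groth_class_in_carrier)

end

section \<open>Functoriality of group completion\<close>

text \<open>A homomorphism sends the slack element \<open>k\<close> of a relation in
  \<open>M\<close> to a slack element \<open>\<phi> k\<close> in \<open>N\<close>, so related pairs
  have related images and the union is over equal sets.\<close>

lemma monoid_hom_groth_map:
  assumes M: "comm_monoid M" and N: "comm_monoid N" and \<phi>: "\<phi> \<in> hom M N"
    and a: "a \<in> carrier M" and b: "b \<in> carrier M"
  shows "(\<Union>(c, d)\<in>groth_class M a b. groth_class N (\<phi> c) (\<phi> d)) = groth_class N (\<phi> a) (\<phi> b)"
proof (rule comm_monoid.UN_groth_class[OF M a b])
  interpret M: comm_monoid M by fact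
  interpret N: comm_monoid N by fact
  fix c d
  assume cd: "c \<in> carrier M" "d \<in> carrier M" "groth_class M c d = groth_class M a b"
  have C: "\<phi> x \<in> carrier N" if "x \<in> carrier M" for x using \<phi> that by (auto simp: hom_def)
  obtain k where k: "k \<in> carrier M" "(c \<otimes>\<^bsub>M\<^esub> b) \<otimes>\<^bsub>M\<^esub> k = (a \<otimes>\<^bsub>M\<^esub> d) \<otimes>\<^bsub>M\<^esub> k"
    using cd a b by (auto simp: M.groth_class_eq_iff)
  from arg_cong[OF k(2), of \<phi>]
  have "(\<phi> c \<otimes>\<^bsub>N\<^esub> \<phi> b) \<otimes>\<^bsub>N\<^esub> \<phi> k = (\<phi> a \<otimes>\<^bsub>N\<^esub> \<phi> d) \<otimes>\<^bsub>N\<^esub> \<phi> k"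
    using \<phi> a b cd k(1) by (simp add: hom_mult)
  then show "groth_class N (\<phi> c) (\<phi> d) = groth_class N (\<phi> a) (\<phi> b)"
    using a b cd k(1) C by (auto simp: N.groth_class_eq_iff)
qed

text \<open>Multiplicativity on classes suffices for \<open>group_hom\<close>, since between groups
  it forces the unit to be preserved.\<close>

lemma group_hom_groth_map:
  assumes M: "comm_monoid M" and N: "comm_monoid N" and \<phi>: "\<phi> \<in> hom M N"
  shows "group_hom (grothendieck_group M) (grothendieck_group N)
    (\<lambda>P. \<Union>(c, d)\<in>P. groth_class N (\<phi> c) (\<phi> d))"
proof -
  interpret M: comm_monoid M by fact
  interpret N: comm_monoid N by fact
  have C: "\<phi> x \<in> carrier N" if "x \<in> carrier M" for x using \<phi> that by (auto simp: hom_def)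
  have "(\<lambda>P. \<Union>(c, d)\<in>P. groth_class N (\<phi> c) (\<phi> d)) \<in>
      hom (grothendieck_group M) (grothendieck_group N)"
  proof (rule homI)
    fix x assume "x \<in> carrier (grothendieck_group M)"
    then show "(\<Union>(c, d)\<in>x. groth_class N (\<phi> c) (\<phi> d)) \<in> carrier (grothendieck_group N)"
      by (elim M.grothendieck_group_cases)
        (simp only: monoid_hom_groth_map[OF assms] C N.groth_class_in_carrier)
  next
    fix x y
    assume "x \<in> carrier (grothendieck_group M)" "y \<in> carrier (grothendieck_group M)"
    then show "(\<Union>(c, d)\<in>x \<otimes>\<^bsub>grothendieck_group M\<^esub> y. groth_class N (\<phi> c) (\<phi> d)) =
        (\<Union>(c, d)\<in>x. groth_class N (\<phi> c) (\<phi> d)) \<otimes>\<^bsub>grothendieck_group N\<^esub>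
        (\<Union>(c, d)\<in>y. groth_class N (\<phi> c) (\<phi> d))"
      by (elim M.grothendieck_group_cases)
        (simp only: monoid_hom_groth_map[OF assms] C M.mult_groth_class N.mult_groth_class
          M.m_closed hom_mult[OF \<phi>])
  qed
  then show ?thesis
    using M.comm_group_grothendieck_group N.comm_group_grothendieck_group
    by (simp add: group_hom_def group_hom_axioms_def comm_group_def)
qed

section \<open>Graphs and graph bundles\<close>

text \<open>An unordered pair determines its two ends only up to exchange, so symmetry of
  \<open>R\<close> is what allows membership in the edge set to be read as \<open>R\<close> itself.
  Cartesian products, subdirect products and pullbacks all have edge sets of this shape.\<close>

lemma adj_pair_edges:
  assumes E: "edges G = {{(a, b), (a', b')} | a b a' b'. R a b a' b'}"
    and sym: "\<And>a b a' b'. R a b a' b' \<Longrightarrow> R a' b' a b"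
  shows "adj G (a, b) (a', b') \<longleftrightarrow> R a b a' b'"
proof
  assume "adj G (a, b) (a', b')"
  then obtain c d c' d' where "{(a, b), (a', b')} = {(c, d), (c', d')}" "R c d c' d'"
    by (auto simp: adj_def E)
  then show "R a b a' b'" by (elim doubleton_eq_iff[THEN iffD1, THEN disjE]) (auto intro: sym)
qed (auto simp: adj_def E)

lemma simple_graph_pair_edges:
  assumes E: "edges G = {{(a, b), (a', b')} | a b a' b'. R a b a' b'}"
    and R: "\<And>a b a' b'. R a b a' b' \<Longrightarrow>
      (a, b) \<in> verts G \<and> (a', b') \<in> verts G \<and> (a, b) \<noteq> (a', b')"
  shows "simple_graph G"
  unfolding simple_graph_def
proof
  fix e assume "e \<in> edges G"
  then obtain a b a' b' where e: "e = {(a, b), (a', b')}" "R a b a' b'" by (auto simp: E)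
  show "e \<in> {{v, w} | v w. v \<in> verts G \<and> w \<in> verts G \<and> v \<noteq> w}"
    unfolding mem_Collect_eq
    by (rule exI[of _ "(a, b)"], rule exI[of _ "(a', b')"]) (use R[OF e(2)] e(1) in simp)
qed

section \<open>Cartesian products and powers\<close>

lemma verts_cart_prod [simp]: "verts (cart_prod F1 F2) = verts F1 \<times> verts F2"
  by (simp add: cart_prod_def)

lemma adj_cart_prod:
  "adj (cart_prod F1 F2) (a, b) (a', b') \<longleftrightarrow>
     (a, b) \<in> verts F1 \<times> verts F2 \<and> (a', b') \<in> verts F1 \<times> verts F2 \<and>
     (adj F1 a a' \<and> b = b' \<or> a = a' \<and> adj F2 b b')"
  by (rule adj_pair_edges) (auto simp: cart_prod_def adj_sym)

lemma simple_graph_cart_prod: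
  assumes "simple_graph F1" "simple_graph F2"
  shows "simple_graph (cart_prod F1 F2)"
  by (rule simple_graph_pair_edges, simp add: cart_prod_def)
    (use assms in \<open>auto dest: adj_verts(3)\<close>)

lemma simple_graph_cart_power:
  assumes "simple_graph F"
  shows "simple_graph (cart_power F n)"
proof (induction n)
  case (Suc n)
  then show ?case
    using graph_iso_map_graph(2)[OF simple_graph_cart_prod[OF assms Suc.IH], of "\<lambda>(a, as). a # as"]
    by (auto simp: inj_on_def)
qed (simp add: simple_graph_def)

lemma verts_cart_power: "verts (cart_power F n) = {as. length as = n \<and> set as \<subseteq> verts F}"
proof (induction n)
  case (Suc n)
  then show ?case by (auto simp: map_graph_def length_Suc_conv image_iff)
qed auto

declare cart_power.simps(2) [simp del]

text \<open>\<open>Cons\<close> is injective, so the renaming in the recursion is an isomorphism.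
  Edges of simple graphs join vertices only, so no membership hypotheses on the lists are
  required.\<close>

lemma adj_cart_power_Suc:
  assumes "simple_graph F"
  shows "adj (cart_power F (Suc n)) (a # as) (b # bs) \<longleftrightarrow>
    adj (cart_prod F (cart_power F n)) (a, as) (b, bs)"
proof -
  let ?P = "cart_prod F (cart_power F n)"
  let ?h = "\<lambda>(a, as). a # as"
  have sP: "simple_graph ?P"
    using assms simple_graph_cart_prod simple_graph_cart_power by blast
  have iso: "graph_iso ?P (cart_power F (Suc n)) ?h" and s: "simple_graph (cart_power F (Suc n))"
    using graph_iso_map_graph[OF sP, of ?h] by (auto simp: inj_on_def cart_power.simps(2))
  have V: "(c, cs) \<in> verts ?P" if "c # cs \<in> verts (cart_power F (Suc n))" for c cs
    using that by (auto simp: verts_cart_power)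
  show ?thesis
  proof
    assume A: "adj (cart_power F (Suc n)) (a # as) (b # bs)"
    then have "(a, as) \<in> verts ?P" "(b, bs) \<in> verts ?P"
      using V adj_verts[OF s A] by blast+
    with A iso show "adj ?P (a, as) (b, bs)" by (fastforce simp: graph_iso_def)
  next
    assume A: "adj ?P (a, as) (b, bs)"
    with iso adj_verts[OF sP A] show "adj (cart_power F (Suc n)) (a # as) (b # bs)"
      by (fastforce simp: graph_iso_def)
  qed
qed

text \<open>An edge of a power moves a single coordinate along an edge of \<open>F\<close>, and this
  coordinate lies in one of the two segments. The segments have fixed lengths, so a concatenation
  determines both of them; the induction peels off the first coordinate.\<close>

lemma adj_cart_power_append:
  assumes F: "simple_graph F" and V: "as \<in> verts (cart_power F m)" "as' \<in> verts (cart_power F m)"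
    "bs \<in> verts (cart_power F n)" "bs' \<in> verts (cart_power F n)"
  shows "adj (cart_power F (m + n)) (as @ bs) (as' @ bs') \<longleftrightarrow>
    adj (cart_power F m) as as' \<and> bs = bs' \<or> as = as' \<and> adj (cart_power F n) bs bs'"
  using V
proof (induction m arbitrary: as as')
  case 0
  then show ?case by (auto simp: adj_def)
next
  case (Suc m)
  obtain a cs a' cs' where [simp]: "as = a # cs" "as' = a' # cs'"
    using Suc.prems by (auto simp: verts_cart_power length_Suc_conv)
  have irr: "\<not> adj F a a" "\<not> adj (cart_power F n) bs bs" for a bs
    using adj_verts(3)[OF F] adj_verts(3)[OF simple_graph_cart_power[OF F]] by blast+
  have "adj (cart_power F (m + n)) (cs @ bs) (cs' @ bs') \<longleftrightarrow>
    adj (cart_power F m) cs cs' \<and> bs = bs' \<or> cs = cs' \<and> adj (cart_power F n) bs bs'"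
    using Suc.prems by (intro Suc.IH) (auto simp: verts_cart_power)
  then show ?case
    using Suc.prems
    by (auto simp: adj_cart_power_Suc[OF F] adj_cart_prod verts_cart_power irr)
qed

lemma graph_iso_cart_power_add:
  assumes F: "simple_graph F"
  shows "graph_iso (cart_prod (cart_power F m) (cart_power F n)) (cart_power F (m + n))
    (\<lambda>(as, bs). as @ bs)"
  unfolding graph_iso_def
proof (intro conjI ballI)
  show "bij_betw (\<lambda>(as, bs). as @ bs) (verts (cart_prod (cart_power F m) (cart_power F n)))
    (verts (cart_power F (m + n)))"
    by (rule bij_betw_byWitness[where f' = "\<lambda>cs. (take m cs, drop m cs)"])
      (auto simp: verts_cart_power dest: in_set_takeD in_set_dropD)
qed (auto simp: adj_cart_power_append[OF F] adj_cart_prod)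

section \<open>Bundles described by lifting of edges\<close>

text \<open>The graph \<open>F\<close> enters the notion of a bundle only through its isomorphism
  type and the cardinality of its vertex set.\<close>

lemma graph_bundle_fiber_iso:
  assumes "graph_bundle F X p G" "graph_iso F F' h"
  shows "graph_bundle F' X p G"
proof -
  have "verts F \<approx> verts F'" using assms(2) by (auto simp: graph_iso_def eqpoll_def)
  then show ?thesis
    using assms graph_iso_trans[OF _ assms(2)] eqpoll_trans
    unfolding graph_bundle_def covering_def graphs_isomorphic_def by meson
qed

text \<open>For adjacent \<open>v\<close> and \<open>w\<close>, the unique lifts of the edge give mutually inverse bijections
  between the two fibres, so the covering conditions reduce to unique lifting of edges, and
  compatibility with the fibres only has to be required in one direction.\<close>

lemma graph_bundle_iff:
  assumes G: "simple_graph G"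
  shows "graph_bundle F X p G \<longleftrightarrow>
    simple_graph X \<and> surj_graph_morphism X G p \<and>
    (\<forall>v\<in>verts G. graphs_isomorphic (fiber X p v) F) \<and>
    (\<forall>x\<in>verts X. \<forall>w. adj G (p x) w \<longrightarrow> (\<exists>!y. adj X x y \<and> p y = w)) \<and>
    (\<forall>x y x' y'. adj X x y \<and> adj X x' y' \<and> p x = p x' \<and> p y = p y' \<and> p x \<noteq> p y \<and>
      adj X x x' \<longrightarrow> adj X y y')"
    (is "?L \<longleftrightarrow> ?R")
proof
  let ?X = "horizontal X p"
  assume L: ?L
  have sX: "simple_graph X" and sm: "surj_graph_morphism X G p"
    and fib: "\<forall>v\<in>verts G. graphs_isomorphic (fiber X p v) F"
    using L by (auto simp: graph_bundle_def)
  have nb: "graph_iso (nbhd ?X x) (nbhd G (p x)) p" if "x \<in> verts X" for x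
    using L that by (auto simp: graph_bundle_def covering_def)
  have adjG: "adj G (p x) (p y)" if "adj X x y" "p x \<noteq> p y" for x y
    using sm that by (auto simp: surj_graph_morphism_def graph_morphism_def)
  have lift: "\<exists>!y. adj X x y \<and> p y = w" if x: "x \<in> verts X" and w: "adj G (p x) w" for x w
  proof -
    have b: "bij_betw p (insert x {z. adj ?X x z}) (insert (p x) {z. adj G (p x) z})"
      using nb[OF x] by (simp add: graph_iso_def)
    \<comment> \<open>The star of \<open>x\<close> also contains its centre. Since \<open>G\<close>
      has no loops, the preimage of \<open>w\<close> in the star is not the centre and is therefore
      a genuine neighbour.\<close>
    have ne: "w \<noteq> p x" using adj_verts(3)[OF G w] by simp
    from b w have "w \<in> p ` insert x {z. adj ?X x z}" by (simp add: bij_betw_def)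
    with ne obtain y where y: "adj ?X x y" "p y = w" by auto
    show ?thesis
    proof (rule ex1I[of _ y])
      show "adj X x y \<and> p y = w" using y by (simp add: adj_horizontal)
      fix y' assume "adj X x y' \<and> p y' = w"
      then have "y' \<in> insert x {z. adj ?X x z}" "p y' = p y"
        using ne y by (auto simp: adj_horizontal)
      then show "y' = y" using b y(1) unfolding bij_betw_def by (blast dest: inj_onD)
    qed
  qed
  have cb: "covering_bij ?X p (p y) x = y" if "adj X x y" "p x \<noteq> p y" for x y
    unfolding covering_bij_def
  proof (rule the_equality)
    show "y \<in> verts ?X \<and> p y = p y \<and> adj ?X x y"
      using that adj_verts(2)[OF sX] by (auto simp: adj_horizontal)
    fix z assume "z \<in> verts ?X \<and> p z = p y \<and> adj ?X x z"
    then have "adj X x z \<and> p z = p y" by (simp add: adj_horizontal)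
    then show "z = y"
      using that lift[OF adj_verts(1)[OF sX that(1)] adjG[OF that]] by blast
  qed
  have par: "adj X y y'" if A: "adj X x y" "adj X x' y'" "p x = p x'" "p y = p y'" "p x \<noteq> p y"
    "adj X x x'" for x y x' y'
  proof -
    have "graph_iso (fiber X p (p x)) (fiber X p (p y)) (covering_bij ?X p (p y))"
      using L adjG[OF A(1,5)] unfolding graph_bundle_def by blast
    moreover have V: "x \<in> verts X" "x' \<in> verts X" using adj_verts[OF sX A(6)] by simp_all
    moreover have "adj (fiber X p (p x)) x x'" using V A(3,6) by (simp add: adj_fiber)
    ultimately have "adj (fiber X p (p y)) (covering_bij ?X p (p y) x) (covering_bij ?X p (p y) x')"
      using A(3) by (simp add: graph_iso_def)
    moreover have "covering_bij ?X p (p y) x = y" using cb A by blast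
    moreover have "covering_bij ?X p (p y) x' = y'" using cb[of x' y'] A by simp
    ultimately show ?thesis by (simp add: adj_fiber)
  qed
  show ?R
    by (intro conjI sX sm fib ballI allI impI lift, assumption+, elim conjE, rule par)
next
  let ?X = "horizontal X p"
  assume R: ?R
  note R' = R[THEN conjunct2, THEN conjunct2]
  from R have sX: "simple_graph X" and sm: "surj_graph_morphism X G p"
    by simp_all
  have fib: "graphs_isomorphic (fiber X p v) F" if "v \<in> verts G" for v
    using R'[THEN conjunct1] that by (rule bspec)
  have lift: "\<exists>!y. adj X x y \<and> p y = w" if "x \<in> verts X" "adj G (p x) w" for x w
    using R'[THEN conjunct2, THEN conjunct1, rule_format, OF that] .
  have par: "adj X y y'" if "adj X x y" "adj X x' y'" "p x = p x'" "p y = p y'" "p x \<noteq> p y"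
      "adj X x x'" for x y x' y'
    by (rule R'[THEN conjunct2, THEN conjunct2, rule_format, of x y x' y'])
      (intro conjI that)
  note XV = adj_verts[OF sX] and GV = adj_verts[OF G]
  have adjG: "adj G (p x) (p y)" if "adj X x y" "p x \<noteq> p y" for x y
    using sm that by (auto simp: surj_graph_morphism_def graph_morphism_def)
  have uniq: "y = y'" if "adj X x y" "adj X x y'" "p y = p y'" "p x \<noteq> p y" for x y y'
    using lift[OF XV(1)[OF that(1)] adjG[OF that(1,4)]] that(1-3) by metis
  have "{x \<in> verts X. p x = v} \<approx> verts F" if "v \<in> verts G" for v
    using fib[OF that] by (auto simp: graphs_isomorphic_def graph_iso_def eqpoll_def)
  moreover have "surj_graph_morphism ?X G p"
    using sm by (auto simp: surj_graph_morphism_def graph_morphism_def adj_horizontal)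
  moreover have "graph_iso (nbhd ?X x) (nbhd G (p x)) p" if x: "x \<in> verts X" for x
  proof -
    have "inj_on p (insert x {z. adj ?X x z})"
      using uniq by (auto simp: inj_on_def adj_horizontal)
    moreover have "p ` insert x {z. adj ?X x z} = insert (p x) {z. adj G (p x) z}"
    proof -
      have "z \<in> p ` {z. adj ?X x z}" if z: "adj G (p x) z" for z
      proof -
        obtain y where "adj X x y" "p y = z" using lift[OF x z] by blast
        then show ?thesis using GV(3)[OF z] by (auto simp: adj_horizontal)
      qed
      then show ?thesis using adjG by (auto simp: adj_horizontal)
    qed
    \<comment> \<open>Every edge of a star contains its centre. Horizontal neighbours of
      \<open>x\<close> do not lie over \<open>p x\<close> and \<open>G\<close> has no loops, so
      \<open>p\<close> matches the edges of the two stars.\<close>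
    moreover have "adj (nbhd ?X x) a b \<longleftrightarrow> adj (nbhd G (p x)) (p a) (p b)"
      if a: "a = x \<or> adj ?X x a" and b: "b = x \<or> adj ?X x b" for a b
    proof -
      have "\<not> adj G v v" for v using GV(3) by blast
      then show ?thesis
        using a b adjG adj_sym[of X] adj_sym[of G] by (auto simp: adj_nbhd adj_horizontal)
    qed
    ultimately show ?thesis by (auto simp: graph_iso_def bij_betw_def)
  qed
  moreover have "graph_iso (fiber X p v) (fiber X p w) (covering_bij ?X p w)"
    if vw: "adj G v w" for v w
  proof -
    have lifted: "adj X x (covering_bij ?X p w x) \<and> p (covering_bij ?X p w x) = w"
      if vw: "adj G v w" and x: "x \<in> verts X" "p x = v" for x v w
    proof -
      obtain y where y: "adj X x y" "p y = w" using lift[of x w] vw x by blast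
      have "covering_bij ?X p w x = y"
        unfolding covering_bij_def
      proof (rule the_equality)
        show "y \<in> verts ?X \<and> p y = w \<and> adj ?X x y"
          using x y XV(2)[OF y(1)] GV(3)[OF vw] by (simp add: adj_horizontal)
        fix z assume "z \<in> verts ?X \<and> p z = w \<and> adj ?X x z"
        then show "z = y"
          using uniq[of x z y] y by (auto simp: adj_horizontal)
      qed
      then show ?thesis using y by simp
    qed
    have wv: "adj G w v" using vw adj_sym by metis
    have ne: "v \<noteq> w" using GV(3)[OF vw] .
    \<comment> \<open>The edge from \<open>x\<close> to its transport, read backwards, is itself a
      lift of the reversed base edge. By uniqueness it is the one along which transport
      returns.\<close>
    have inv: "covering_bij ?X p v (covering_bij ?X p w x) = x"
      if "adj G v w" "x \<in> verts X" "p x = v" for x v w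
    proof -
      note l = lifted[OF that]
      have "adj G w v" using that(1) adj_sym by metis
      from lifted[OF this, of "covering_bij ?X p w x"] l XV(2)
      have "adj X (covering_bij ?X p w x) (covering_bij ?X p v (covering_bij ?X p w x))"
        "p (covering_bij ?X p v (covering_bij ?X p w x)) = v" by auto
      moreover have "adj X (covering_bij ?X p w x) x" using l adj_sym by metis
      ultimately show ?thesis
        using uniq[of "covering_bij ?X p w x" _ x] l that(3) GV(3)[OF that(1)] by simp
    qed
    have im: "covering_bij ?X p w ` {x \<in> verts X. p x = v} \<subseteq> {x \<in> verts X. p x = w}"
      if "adj G v w" for v w
      using lifted[OF that] XV(2) by blast
    have "bij_betw (covering_bij ?X p w) {x \<in> verts X. p x = v} {x \<in> verts X. p x = w}"
      using inv[OF vw] inv[OF wv] im[OF vw] im[OF wv]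
      by (intro bij_betw_byWitness[where f' = "covering_bij ?X p v"]) simp_all
    moreover have "adj X x x' \<longleftrightarrow> adj X (covering_bij ?X p w x) (covering_bij ?X p w x')"
      if "x \<in> verts X" "p x = v" "x' \<in> verts X" "p x' = v" for x x'
    proof -
      note l = lifted[OF vw that(1,2)] lifted[OF vw that(3,4)]
      have "adj X (covering_bij ?X p w x) x" "adj X (covering_bij ?X p w x') x'"
        using l adj_sym by metis+
      \<comment> \<open>\<open>par\<close> is used twice, for the two lifts and for the same lifts
        reversed; together they give both directions of the isomorphism.\<close>
      then show ?thesis
        using par[of x "covering_bij ?X p w x" x' "covering_bij ?X p w x'"]
          par[of "covering_bij ?X p w x" x "covering_bij ?X p w x'" x'] l that(2,4) ne by auto
    qed
    ultimately show ?thesis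
      unfolding graph_iso_def adj_fiber using im[OF vw] by auto
  qed
  ultimately show ?L
    unfolding graph_bundle_def covering_def using sX sm fib by simp
qed

section \<open>Subdirect products and pullbacks\<close>

text \<open>Each fibre of the identity is a single vertex without edges, which is the zeroth power
  of any \<open>F\<close>.\<close>

lemma graph_bundle_id:
  assumes G: "simple_graph G"
  shows "graph_bundle (cart_power F 0) G id G"
proof -
  have "graph_iso (fiber G id v) (cart_power F 0) (\<lambda>_. [])" if "v \<in> verts G" for v
  proof -
    have "\<not> adj (fiber G id v) v v" "\<not> adj (cart_power F 0) [] []"
      using adj_verts(3)[OF G] by (auto simp: adj_fiber) (simp add: adj_def)
    moreover have "verts (fiber G id v) = {v}" using that by auto
    ultimately show ?thesis by (auto simp: graph_iso_def bij_betw_def)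
  qed
  then have "\<forall>v\<in>verts G. graphs_isomorphic (fiber G id v) (cart_power F 0)"
    unfolding graphs_isomorphic_def by blast
  then show ?thesis
    using G adj_verts(3)[OF G]
    by (auto simp: graph_bundle_iff surj_graph_morphism_def graph_morphism_def)
qed

text \<open>Written with \<open>fst B\<close> and \<open>snd B\<close> instead of explicit pairs, so
  that it also rewrites iterated products and products of pullbacks.\<close>

lemma verts_subdirect:
  "(x, y) \<in> verts (fst (subdirect G B C)) \<longleftrightarrow>
     x \<in> verts (fst B) \<and> y \<in> verts (fst C) \<and> snd B x = snd C y"
  by (cases B; cases C) (simp add: subdirect_def Let_def)

lemma snd_subdirect: "snd (subdirect G B C) = (\<lambda>(x, y). snd B x)"
  by (cases B; cases C) (simp add: subdirect_def Let_def)

lemma edges_subdirect: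
  "edges (fst (subdirect G B C)) = {{(x, y), (x', y')} | x y x' y'.
     x \<in> verts (fst B) \<and> y \<in> verts (fst C) \<and> snd B x = snd C y \<and>
     x' \<in> verts (fst B) \<and> y' \<in> verts (fst C) \<and> snd B x' = snd C y' \<and>
     (x = x' \<and> adj (fst C) y y' \<or> adj (fst B) x x' \<and> snd B x = snd B x' \<and> y = y' \<or>
      adj (fst B) x x' \<and> adj G (snd B x) (snd B x') \<and> adj (fst C) y y')}"
  by (cases B; cases C) (simp add: subdirect_def Let_def conj_assoc)

lemma adj_subdirect:
  "adj (fst (subdirect G B C)) (x, y) (x', y') \<longleftrightarrow>
     x \<in> verts (fst B) \<and> y \<in> verts (fst C) \<and> snd B x = snd C y \<and>
     x' \<in> verts (fst B) \<and> y' \<in> verts (fst C) \<and> snd B x' = snd C y' \<and>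
     (x = x' \<and> adj (fst C) y y' \<or> adj (fst B) x x' \<and> snd B x = snd B x' \<and> y = y' \<or>
      adj (fst B) x x' \<and> adj G (snd B x) (snd B x') \<and> adj (fst C) y y')"
  by (rule adj_pair_edges[OF edges_subdirect]) (auto simp: adj_sym)

lemma simple_graph_subdirect:
  assumes X: "simple_graph X" and Y: "simple_graph Y"
  shows "simple_graph (fst (subdirect G (X, p) (Y, q)))"
  by (rule simple_graph_pair_edges[OF edges_subdirect])
    (use adj_verts(3)[OF X] adj_verts(3)[OF Y] in \<open>auto simp: verts_subdirect\<close>)

text \<open>\<open>graph_bundle_iff\<close> supplies one implication; applied to the two lifts read
  backwards it supplies the other.\<close>

lemma graph_bundle_adj_iff:
  assumes G: "simple_graph G" and B: "graph_bundle F X p G"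
    and "adj X x y" "adj X x' y'" "p x = p x'" "p y = p y'" "p x \<noteq> p y"
  shows "adj X x x' \<longleftrightarrow> adj X y y'"
proof -
  have par: "\<forall>x y x' y'. adj X x y \<and> adj X x' y' \<and> p x = p x' \<and> p y = p y' \<and> p x \<noteq> p y \<and>
      adj X x x' \<longrightarrow> adj X y y'"
    using B unfolding graph_bundle_iff[OF G] by (elim conjE)
  have "adj X y x" "adj X y' x'" using assms(3,4) adj_sym by metis+
  then have "adj X y y' \<Longrightarrow> adj X x x'"
    by (intro par[rule_format, of y x y' x'] conjI assms(5,6) assms(7)[symmetric])
  moreover have "adj X x x' \<Longrightarrow> adj X y y'"
    by (intro par[rule_format, of x y x' y'] conjI assms(3-))
  ultimately show ?thesis by blast
qed

lemma graph_bundle_simple: "graph_bundle F X p G \<Longrightarrow> simple_graph X"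
  by (simp add: graph_bundle_def)

lemma graph_bundle_verts: "graph_bundle F X p G \<Longrightarrow> p ` verts X = verts G"
  by (simp add: graph_bundle_def surj_graph_morphism_def)

lemma graph_bundle_adj: "graph_bundle F X p G \<Longrightarrow> adj X x y \<Longrightarrow> adj G (p x) (p y) \<or> p x = p y"
  by (simp add: graph_bundle_def surj_graph_morphism_def graph_morphism_def)

lemma graph_bundle_fiber:
  assumes "graph_bundle F X p G" "v \<in> verts G"
  obtains h where "graph_iso (fiber X p v) F h"
  using assms unfolding graph_bundle_def graphs_isomorphic_def by blast

lemma graph_bundle_lift:
  assumes "simple_graph G" "graph_bundle F X p G" "x \<in> verts X" "adj G (p x) w"
  obtains y where "adj X x y" "y \<in> verts X" "p y = w" "\<And>z. adj X x z \<Longrightarrow> p z = w \<Longrightarrow> z = y"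
proof -
  have "\<forall>x\<in>verts X. \<forall>w. adj G (p x) w \<longrightarrow> (\<exists>!y. adj X x y \<and> p y = w)"
    using assms(2) unfolding graph_bundle_iff[OF assms(1)] by (elim conjE)
  with assms(3,4) have "\<exists>!y. adj X x y \<and> p y = w" by blast
  then obtain y where y: "adj X x y" "p y = w" and u: "\<And>z. adj X x z \<and> p z = w \<Longrightarrow> z = y"
    by (elim ex1E) blast
  show thesis
    using that[OF y(1) _ y(2)] u adj_verts(2)[OF graph_bundle_simple[OF assms(2)] y(1)] by blast
qed

lemma graph_bundle_lift_unique:
  assumes "simple_graph G" "graph_bundle F X p G"
    and "adj X x y" "adj X x y'" "p y = p y'" "p x \<noteq> p y"
  shows "y = y'"
proof -
  have "x \<in> verts X" using adj_verts(1)[OF graph_bundle_simple[OF assms(2)] assms(3)] .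
  moreover have "adj G (p x) (p y)" using graph_bundle_adj[OF assms(2,3)] assms(6) by simp
  ultimately obtain z where "\<And>z'. adj X x z' \<Longrightarrow> p z' = p y \<Longrightarrow> z' = z"
    by (rule graph_bundle_lift[OF assms(1,2)]) blast
  from this[OF assms(3)] this[OF assms(4)] show ?thesis using assms(5) by simp
qed

text \<open>The unique lift is spelled out as existence together with a comparison, which suits
  constructions where the lift is named and an arbitrary competitor is identified with it.\<close>

lemma graph_bundleI:
  assumes G: "simple_graph G" and X: "simple_graph X"
    and surj: "p ` verts X = verts G"
    and hom: "\<And>x y. adj X x y \<Longrightarrow> adj G (p x) (p y) \<or> p x = p y"
    and fib: "\<And>v. v \<in> verts G \<Longrightarrow> graphs_isomorphic (fiber X p v) F"
    and lift: "\<And>x w. x \<in> verts X \<Longrightarrow> adj G (p x) w \<Longrightarrow>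
      \<exists>y. adj X x y \<and> p y = w \<and> (\<forall>z. adj X x z \<and> p z = w \<longrightarrow> z = y)"
    and par: "\<And>x y x' y'. adj X x y \<Longrightarrow> adj X x' y' \<Longrightarrow> p x = p x' \<Longrightarrow> p y = p y' \<Longrightarrow>
      p x \<noteq> p y \<Longrightarrow> adj X x x' \<Longrightarrow> adj X y y'"
  shows "graph_bundle F X p G"
proof -
  have lift1: "\<exists>!y. adj X x y \<and> p y = w" if xw: "x \<in> verts X" "adj G (p x) w" for x w
  proof -
    obtain y where "adj X x y \<and> p y = w" "\<forall>z. adj X x z \<and> p z = w \<longrightarrow> z = y"
      using lift[OF xw] by blast
    then show ?thesis by - (rule ex1I[of _ y], assumption, blast)
  qed
  have sm: "surj_graph_morphism X G p"
    using surj hom by (simp add: surj_graph_morphism_def graph_morphism_def)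
  show ?thesis
    unfolding graph_bundle_iff[OF G]
    by (intro conjI X sm ballI allI impI fib lift1, assumption+, elim conjE, rule par)
qed

text \<open>Over an edge of \<open>G\<close> only clause (III) is possible, so a lift is a pair of
  lifts in the factors. Inside a fibre only (I) and (II) are possible, and these are the edges of
  the Cartesian product of the two fibres.\<close>

lemma graph_bundle_subdirect:
  assumes G: "simple_graph G" and X: "graph_bundle F1 X p G" and Y: "graph_bundle F2 Y q G"
  shows "graph_bundle (cart_prod F1 F2) (fst (subdirect G (X, p) (Y, q)))
    (snd (subdirect G (X, p) (Y, q))) G"
proof -
  let ?S = "fst (subdirect G (X, p) (Y, q))"
  note sX = graph_bundle_simple[OF X] and sY = graph_bundle_simple[OF Y]
  have ne: "v \<noteq> w" if "adj G v w" for v w using adj_verts(3)[OF G that] .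
  have III: "adj X x x' \<and> adj Y y y'"
    if "adj ?S (x, y) (x', y')" "p x \<noteq> p x'" for x y x' y'
    using that by (auto simp: adj_subdirect)
  have vert: "x = x' \<and> adj Y y y' \<or> adj X x x' \<and> y = y'"
    if "adj ?S (x, y) (x', y')" "p x = p x'" for x y x' y'
    using that ne by (auto simp: adj_subdirect)
  have "graph_bundle (cart_prod F1 F2) ?S (\<lambda>(x, y). p x) G"
  proof (rule graph_bundleI[OF G simple_graph_subdirect[OF sX sY]])
    show "(\<lambda>(x, y). p x) ` verts ?S = verts G"
    proof (intro equalityI subsetI)
      fix v assume "v \<in> verts G"
      then obtain x y where "x \<in> verts X" "p x = v" "y \<in> verts Y" "q y = v"
        using graph_bundle_verts[OF X] graph_bundle_verts[OF Y] by (metis imageE)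
      then show "v \<in> (\<lambda>(x, y). p x) ` verts ?S"
        by (intro image_eqI[of _ _ "(x, y)"]) (auto simp: verts_subdirect)
    next
      fix v assume "v \<in> (\<lambda>(x, y). p x) ` verts ?S"
      then have "v \<in> p ` verts X" by (auto simp: verts_subdirect)
      then show "v \<in> verts G" using graph_bundle_verts[OF X] by simp
    qed
  next
    fix a b assume "adj ?S a b"
    then show "adj G (case a of (x, y) \<Rightarrow> p x) (case b of (x, y) \<Rightarrow> p x) \<or>
        (case a of (x, y) \<Rightarrow> p x) = (case b of (x, y) \<Rightarrow> p x)"
      using graph_bundle_adj[OF X] by (cases a; cases b) (auto simp: adj_subdirect)
  next
    fix v assume v: "v \<in> verts G"
    obtain h k where h: "graph_iso (fiber X p v) F1 h" and k: "graph_iso (fiber Y q v) F2 k"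
      using graph_bundle_fiber[OF X v] graph_bundle_fiber[OF Y v] by metis
    have V: "verts (fiber ?S (\<lambda>(x, y). p x) v) = verts (fiber X p v) \<times> verts (fiber Y q v)"
      by (auto simp: verts_subdirect)
    have A: "adj (fiber ?S (\<lambda>(x, y). p x) v) (x, y) (x', y') \<longleftrightarrow>
        adj (cart_prod F1 F2) (h x, k y) (h x', k y')"
      if xy: "x \<in> verts (fiber X p v)" "y \<in> verts (fiber Y q v)"
        "x' \<in> verts (fiber X p v)" "y' \<in> verts (fiber Y q v)" for x y x' y'
    proof -
      note hb = graph_iso_def[THEN iffD1, OF h, THEN conjunct1]
        and kb = graph_iso_def[THEN iffD1, OF k, THEN conjunct1]
      have V': "h x \<in> verts F1" "h x' \<in> verts F1" "k y \<in> verts F2" "k y' \<in> verts F2"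
        using bij_betw_apply[OF hb] bij_betw_apply[OF kb] xy by blast+
      have eq: "h x = h x' \<longleftrightarrow> x = x'" "k y = k y' \<longleftrightarrow> y = y'"
        using inj_on_eq_iff[OF bij_betw_imp_inj_on[OF hb] xy(1,3)]
          inj_on_eq_iff[OF bij_betw_imp_inj_on[OF kb] xy(2,4)] by blast+
      have "adj F1 (h x) (h x') \<longleftrightarrow> adj (fiber X p v) x x'"
        "adj F2 (k y) (k y') \<longleftrightarrow> adj (fiber Y q v) y y'"
        using h k xy unfolding graph_iso_def by blast+
      then have ad: "adj F1 (h x) (h x') \<longleftrightarrow> adj X x x'" "adj F2 (k y) (k y') \<longleftrightarrow> adj Y y y'"
        using xy by (simp_all add: adj_fiber)
      \<comment> \<open>Within the fibre over \<open>v\<close>, clause (III) would require a loop at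
        \<open>v\<close>.\<close>
      have "\<not> adj G v v" using ne by blast
      then show ?thesis
        using xy by (auto simp: adj_cart_prod adj_fiber verts_subdirect adj_subdirect V' eq ad)
    qed
    have "graph_iso (fiber ?S (\<lambda>(x, y). p x) v) (cart_prod F1 F2) (map_prod h k)"
      unfolding graph_iso_def V
    proof (intro conjI ballI)
      show "bij_betw (map_prod h k) (verts (fiber X p v) \<times> verts (fiber Y q v))
          (verts (cart_prod F1 F2))"
        using h k by (simp only: graph_iso_def verts_cart_prod bij_betw_map_prod)
    qed (clarsimp simp del: verts_fiber simp: A)
    then show "graphs_isomorphic (fiber ?S (\<lambda>(x, y). p x) v) (cart_prod F1 F2)"
      unfolding graphs_isomorphic_def by blast
  next
    fix a w
    assume a: "a \<in> verts ?S" and w: "adj G (case a of (x, y) \<Rightarrow> p x) w"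
    obtain x y where [simp]: "a = (x, y)" by (cases a)
    have xy: "x \<in> verts X" "y \<in> verts Y" "p x = q y" "adj G (p x) w" "adj G (q y) w"
      using a w by (auto simp: verts_subdirect)
    obtain x' where x': "adj X x x'" "x' \<in> verts X" "p x' = w"
      "\<And>z. adj X x z \<Longrightarrow> p z = w \<Longrightarrow> z = x'"
      by (rule graph_bundle_lift[OF G X xy(1,4)]) blast
    obtain y' where y': "adj Y y y'" "y' \<in> verts Y" "q y' = w"
      "\<And>z. adj Y y z \<Longrightarrow> q z = w \<Longrightarrow> z = y'"
      by (rule graph_bundle_lift[OF G Y xy(2,5)]) blast
    show "\<exists>b. adj ?S a b \<and> (case b of (x, y) \<Rightarrow> p x) = w \<and>
        (\<forall>c. adj ?S a c \<and> (case c of (x, y) \<Rightarrow> p x) = w \<longrightarrow> c = b)"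
    proof (intro exI[of _ "(x', y')"] conjI allI impI)
      show "adj ?S a (x', y')" using x'(1-3) y'(1-3) xy by (simp add: adj_subdirect)
      fix c assume c: "adj ?S a c \<and> (case c of (x, y) \<Rightarrow> p x) = w"
      obtain x'' y'' where [simp]: "c = (x'', y'')" by (cases c)
      have c': "adj ?S (x, y) (x'', y'')" "p x'' = w" using c by simp_all
      have "p x \<noteq> p x''" using ne[OF xy(4)] c'(2) by simp
      from III[OF c'(1) this] have "adj X x x''" "adj Y y y''" by simp_all
      moreover have "p x'' = q y''" using c'(1) by (simp add: adj_subdirect)
      ultimately show "c = (x', y')" using x'(4)[of x''] y'(4)[of y''] c'(2) by simp
    qed (use x'(3) in simp)
  next
    fix a b a' b'
    assume H: "adj ?S a b" "adj ?S a' b'"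
      "(case a of (x, y) \<Rightarrow> p x) = (case a' of (x, y) \<Rightarrow> p x)"
      "(case b of (x, y) \<Rightarrow> p x) = (case b' of (x, y) \<Rightarrow> p x)"
      "(case a of (x, y) \<Rightarrow> p x) \<noteq> (case b of (x, y) \<Rightarrow> p x)" "adj ?S a a'"
    obtain x y x1 y1 x' y' x1' y1' where e: "a = (x, y)" "b = (x1, y1)" "a' = (x', y')" "b' = (x1', y1')"
      by (cases a; cases b; cases a'; cases b')
    note H = H[unfolded e prod.case]
    have 1: "adj X x x1" "adj Y y y1" and 2: "adj X x' x1'" "adj Y y' y1'"
      using III[OF H(1)] III[OF H(2)] H(3-5) by auto
    have V: "x1 \<in> verts X" "y1 \<in> verts Y" "x1' \<in> verts X" "y1' \<in> verts Y"
      "q y = p x" "q y1 = p x1" "q y' = p x'" "q y1' = p x1'" "x \<in> verts X" "y \<in> verts Y"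
      using H(1,2) by (auto simp: adj_subdirect)
    have "adj G (p x) (p x1)" using graph_bundle_adj[OF X 1(1)] H(5) by simp
    \<comment> \<open>A vertical edge moves one coordinate. In the resting one both lifts start at
      the same point and hence end at the same point; in the moving one adjacency is transported by
      the factor.\<close>
    from vert[OF H(6,3)] consider "x = x'" "adj Y y y'" | "adj X x x'" "y = y'" by blast
    then show "adj ?S b b'"
    proof cases
      case 1
      then have "x1 = x1'"
        using graph_bundle_lift_unique[OF G X \<open>adj X x x1\<close>, of x1'] 2 H(4,5) by simp
      moreover have "adj Y y1 y1'"
        using graph_bundle_adj_iff[OF G Y \<open>adj Y y y1\<close> 2(2)] 1 V H(3-5) by simp
      ultimately show ?thesis using V H(4) by (simp add: e adj_subdirect)
    next
      case A: 2
      then have "y1 = y1'"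
        using graph_bundle_lift_unique[OF G Y 1(2), of y1'] 2(2) V H(4,5) by simp
      moreover have "adj X x1 x1'"
        using graph_bundle_adj_iff[OF G X 1(1) 2(1)] A H(3-5) by simp
      ultimately show ?thesis using V H(4) by (simp add: e adj_subdirect)
    qed
  qed
  then show ?thesis by (simp add: snd_subdirect)
qed

section \<open>Pullbacks of bundles\<close>

lemma verts_pullback:
  "(v, x) \<in> verts (fst (pullback G H f B)) \<longleftrightarrow>
     v \<in> verts G \<and> x \<in> verts (fst B) \<and> f v = snd B x"
  by (cases B) (simp add: pullback_def Let_def)

lemma snd_pullback: "snd (pullback G H f B) = fst"
  by (cases B) (simp add: pullback_def Let_def)

lemma edges_pullback:
  "edges (fst (pullback G H f B)) = {{(v, x), (v', x')} | v x v' x'.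
     v \<in> verts G \<and> x \<in> verts (fst B) \<and> f v = snd B x \<and>
     v' \<in> verts G \<and> x' \<in> verts (fst B) \<and> f v' = snd B x' \<and>
     (v = v' \<and> adj (fst B) x x' \<or> adj G v v' \<and> f v = f v' \<and> x = x' \<or>
      adj G v v' \<and> adj H (f v) (f v') \<and> adj (fst B) x x')}"
  by (cases B) (simp add: pullback_def Let_def conj_assoc)

lemma adj_pullback:
  "adj (fst (pullback G H f B)) (v, x) (v', x') \<longleftrightarrow>
     v \<in> verts G \<and> x \<in> verts (fst B) \<and> f v = snd B x \<and>
     v' \<in> verts G \<and> x' \<in> verts (fst B) \<and> f v' = snd B x' \<and>
     (v = v' \<and> adj (fst B) x x' \<or> adj G v v' \<and> f v = f v' \<and> x = x' \<or>
      adj G v v' \<and> adj H (f v) (f v') \<and> adj (fst B) x x')"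
  by (rule adj_pair_edges[OF edges_pullback]) (auto simp: adj_sym)

lemma simple_graph_pullback:
  assumes G: "simple_graph G" and X: "simple_graph X"
  shows "simple_graph (fst (pullback G H f (X, p)))"
  by (rule simple_graph_pair_edges[OF edges_pullback])
    (use adj_verts(3)[OF G] adj_verts(3)[OF X] in \<open>auto simp: verts_pullback\<close>)

lemma graph_bundle_pullback:
  assumes G: "simple_graph G" and H: "simple_graph H" and f: "graph_morphism G H f"
    and X: "graph_bundle F X p H"
  shows "graph_bundle F (fst (pullback G H f (X, p))) (snd (pullback G H f (X, p))) G"
proof -
  let ?P = "fst (pullback G H f (X, p))"
  note sX = graph_bundle_simple[OF X]
  have neG: "v \<noteq> w" if "adj G v w" for v w using adj_verts(3)[OF G that] .
  have neH: "v \<noteq> w" if "adj H v w" for v w using adj_verts(3)[OF H that] .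
  have fV: "f v \<in> verts H" if "v \<in> verts G" for v
    using f that by (auto simp: graph_morphism_def)
  have fadj: "adj H (f v) (f w) \<or> f v = f w" if "adj G v w" for v w
    using f that by (simp add: graph_morphism_def)
  \<comment> \<open>\<open>H\<close> has no loops, so between different fibres the clause for
    collapsed edges and the clause for lifted edges exclude each other, and whether
    \<open>f v = f w\<close> decides between them.\<close>
  have horiz: "adj G v w \<and> (f v = f w \<and> x = y \<or> f v \<noteq> f w \<and> adj H (f v) (f w) \<and> adj X x y)"
    if "adj ?P (v, x) (w, y)" "v \<noteq> w" for v x w y
  proof -
    have "\<not> adj H (f v) (f w)" if "f v = f w" using neH that by metis
    then show ?thesis using that by (auto simp: adj_pullback)
  qed
  have vert: "adj X x y" if "adj ?P (v, x) (v, y)" for v x y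
    using that neG by (auto simp: adj_pullback)
  have "graph_bundle F ?P fst G"
  proof (rule graph_bundleI[OF G simple_graph_pullback[OF G sX]])
    show "fst ` verts ?P = verts G"
    proof (intro equalityI subsetI)
      fix v assume v: "v \<in> verts G"
      then obtain x where "x \<in> verts X" "p x = f v"
        using fV[OF v] graph_bundle_verts[OF X] by (metis imageE)
      then show "v \<in> fst ` verts ?P"
        using v by (intro image_eqI[of _ _ "(v, x)"]) (auto simp: verts_pullback)
    qed (auto simp: verts_pullback)
  next
    fix a b assume "adj ?P a b"
    then show "adj G (fst a) (fst b) \<or> fst a = fst b"
      by (cases a; cases b) (auto simp: adj_pullback)
  next
    fix v assume v: "v \<in> verts G"
    obtain h where h: "graph_iso (fiber X p (f v)) F h"
      by (rule graph_bundle_fiber[OF X fV[OF v]])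
    have "graph_iso (fiber ?P fst v) (fiber X p (f v)) snd"
      unfolding graph_iso_def
    proof (intro conjI ballI)
      show "bij_betw snd (verts (fiber ?P fst v)) (verts (fiber X p (f v)))"
        using v by (intro bij_betw_byWitness[where f' = "Pair v"]) (auto simp: verts_pullback)
      \<comment> \<open>The second and third clauses would need a loop at \<open>v\<close>, so the
        fibre of the pullback over \<open>v\<close> has exactly the edges of the fibre over
        \<open>f v\<close>.\<close>
      have "\<not> adj G v v" using neG by blast
      then show "adj (fiber ?P fst v) a b \<longleftrightarrow> adj (fiber X p (f v)) (snd a) (snd b)"
        if "a \<in> verts (fiber ?P fst v)" "b \<in> verts (fiber ?P fst v)" for a b
        using that by (cases a; cases b) (auto simp: adj_fiber adj_pullback verts_pullback)
    qed
    then show "graphs_isomorphic (fiber ?P fst v) F"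
      using graph_iso_trans h unfolding graphs_isomorphic_def by blast
  next
    fix a w
    assume a: "a \<in> verts ?P" and w: "adj G (fst a) w"
    obtain v x where [simp]: "a = (v, x)" by (cases a)
    have vx: "v \<in> verts G" "x \<in> verts X" "f v = p x" "adj G v w"
      using a w by (auto simp: verts_pullback)
    have wV: "w \<in> verts G" "v \<noteq> w" using adj_verts[OF G vx(4)] by auto
    show "\<exists>b. adj ?P a b \<and> fst b = w \<and> (\<forall>c. adj ?P a c \<and> fst c = w \<longrightarrow> c = b)"
    proof (cases "f v = f w")
      case True
      have "adj ?P a (w, x)" using vx wV(1) True by (simp add: adj_pullback)
      moreover have "c = (w, x)" if c: "adj ?P a c" "fst c = w" for c
      proof -
        obtain z where z: "c = (w, z)" using c(2) by (cases c) auto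
        have "adj ?P (v, x) (w, z)" using c(1) z by simp
        from horiz[OF this wV(2)] show ?thesis using True z by simp
      qed
      ultimately show ?thesis
        by - (rule exI[of _ "(w, x)"], intro conjI allI impI fst_conv, assumption, elim conjE, blast)
    next
      case False
      then have fvw: "adj H (p x) (f w)" using fadj[OF vx(4)] vx(3) by simp
      obtain y where y: "adj X x y" "y \<in> verts X" "p y = f w"
        "\<And>z. adj X x z \<Longrightarrow> p z = f w \<Longrightarrow> z = y"
        by (rule graph_bundle_lift[OF H X vx(2) fvw]) blast
      have "adj ?P a (w, y)" using vx wV y(1-3) fvw by (simp add: adj_pullback)
      moreover have "c = (w, y)" if c: "adj ?P a c" "fst c = w" for c
      proof -
        obtain z where z: "c = (w, z)" using c(2) by (cases c) auto
        have vw: "adj ?P (v, x) (w, z)" using c(1) z by simp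
        have "adj X x z" using horiz[OF vw wV(2)] False by simp
        moreover have "p z = f w" using vw by (simp add: adj_pullback)
        ultimately show ?thesis using y(4)[of z] z by simp
      qed
      ultimately show ?thesis
        by - (rule exI[of _ "(w, y)"], intro conjI allI impI fst_conv, assumption, elim conjE, blast)
    qed
  next
    fix a b a' b'
    assume A: "adj ?P a b" "adj ?P a' b'" "fst a = fst a'" "fst b = fst b'" "fst a \<noteq> fst b"
      "adj ?P a a'"
    obtain v x w y x' y' where e: "a = (v, x)" "b = (w, y)" "a' = (v, x')" "b' = (w, y')"
      using A(3,4) by (cases a; cases b; cases a'; cases b') auto
    note A = A[unfolded e fst_conv]
    have V: "w \<in> verts G" "y \<in> verts X" "y' \<in> verts X" "p y = f w" "p y' = f w" "p x = f v" "p x' = f v"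
      using A(1,2) by (auto simp: adj_pullback)
    have xx': "adj X x x'" using vert[OF A(6)] .
    have "adj X y y'"
    proof (cases "f v = f w")
      case True
      \<comment> \<open>Over a collapsed edge \<open>y = x\<close> and \<open>y' = x'\<close>, so
        the required edge is the given one.\<close>
      then show ?thesis using horiz[OF A(1,5)] horiz[OF A(2,5)] xx' by simp
    next
      case False
      then have "adj X x y" "adj X x' y'" using horiz[OF A(1,5)] horiz[OF A(2,5)] by auto
      then show ?thesis using graph_bundle_adj_iff[OF H X, of x y x' y'] xx' V False by simp
    qed
    then show "adj ?P b b'" using V by (simp add: e adj_pullback)
  qed
  then show ?thesis by (simp add: snd_pullback)
qed

section \<open>Equivalence of bundles\<close>

text \<open>Tailored to canonical equivalences: the map and its inverse are both explicit
  rearrangements of coordinates, so bijectivity becomes a check on vertices.\<close>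

lemma bundle_equivI:
  assumes "\<And>x. x \<in> verts (fst B) \<Longrightarrow>
      \<Phi> x \<in> verts (fst C) \<and> \<Psi> (\<Phi> x) = x \<and> snd C (\<Phi> x) = snd B x"
    and "\<And>y. y \<in> verts (fst C) \<Longrightarrow> \<Psi> y \<in> verts (fst B) \<and> \<Phi> (\<Psi> y) = y"
    and "\<And>x y. x \<in> verts (fst B) \<Longrightarrow> y \<in> verts (fst B) \<Longrightarrow>
      adj (fst B) x y \<longleftrightarrow> adj (fst C) (\<Phi> x) (\<Phi> y)"
  shows "bundle_equiv B C"
proof -
  have "bij_betw \<Phi> (verts (fst B)) (verts (fst C))"
    by (rule bij_betw_byWitness[where f' = \<Psi>]) (use assms(1,2) in auto)
  then have "graph_iso (fst B) (fst C) \<Phi>" using assms(3) by (simp add: graph_iso_def)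
  then show ?thesis using assms(1) by (auto simp: bundle_equiv_def split: prod.splits)
qed

text \<open>Supplies an inverse together with the rewrite rules for both directions, so that the
  symmetry of equivalence and its compatibility with constructions reduce to simplification.\<close>

lemma bundle_equivE:
  assumes "bundle_equiv B C"
  obtains \<Phi> \<Psi> where
    "\<And>x. x \<in> verts (fst B) \<Longrightarrow> \<Phi> x \<in> verts (fst C)"
    "\<And>x. x \<in> verts (fst B) \<Longrightarrow> \<Psi> (\<Phi> x) = x"
    "\<And>x. x \<in> verts (fst B) \<Longrightarrow> snd C (\<Phi> x) = snd B x"
    "\<And>y. y \<in> verts (fst C) \<Longrightarrow> \<Psi> y \<in> verts (fst B)"
    "\<And>y. y \<in> verts (fst C) \<Longrightarrow> \<Phi> (\<Psi> y) = y"
    "\<And>y. y \<in> verts (fst C) \<Longrightarrow> snd B (\<Psi> y) = snd C y"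
    "\<And>x y. x \<in> verts (fst B) \<Longrightarrow> y \<in> verts (fst B) \<Longrightarrow>
      adj (fst C) (\<Phi> x) (\<Phi> y) \<longleftrightarrow> adj (fst B) x y"
    "\<And>x y. x \<in> verts (fst C) \<Longrightarrow> y \<in> verts (fst C) \<Longrightarrow>
      adj (fst B) (\<Psi> x) (\<Psi> y) \<longleftrightarrow> adj (fst C) x y"
proof -
  obtain \<Phi> where iso: "graph_iso (fst B) (fst C) \<Phi>"
    and pr: "\<And>x. x \<in> verts (fst B) \<Longrightarrow> snd C (\<Phi> x) = snd B x"
    using assms by (auto simp: bundle_equiv_def split: prod.splits)
  define \<Psi> where "\<Psi> = inv_into (verts (fst B)) \<Phi>"
  have iso': "graph_iso (fst C) (fst B) \<Psi>" unfolding \<Psi>_def by (rule graph_iso_sym[OF iso])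
  have b: "bij_betw \<Phi> (verts (fst B)) (verts (fst C))" using iso by (simp add: graph_iso_def)
  have b': "bij_betw \<Psi> (verts (fst C)) (verts (fst B))" using iso' by (simp add: graph_iso_def)
  have r: "\<Phi> (\<Psi> y) = y" if "y \<in> verts (fst C)" for y
    unfolding \<Psi>_def using bij_betw_inv_into_right[OF b that] .
  show thesis
  proof (rule that[of \<Phi> \<Psi>])
    show "\<Psi> (\<Phi> x) = x" if "x \<in> verts (fst B)" for x
      unfolding \<Psi>_def using bij_betw_inv_into_left[OF b that] .
    show "snd B (\<Psi> y) = snd C y" if "y \<in> verts (fst C)" for y
      using pr[OF bij_betw_apply[OF b' that]] r[OF that] by simp
    show "adj (fst C) (\<Phi> x) (\<Phi> y) \<longleftrightarrow> adj (fst B) x y"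
      if "x \<in> verts (fst B)" "y \<in> verts (fst B)" for x y
      using iso that by (simp add: graph_iso_def)
    show "adj (fst B) (\<Psi> x) (\<Psi> y) \<longleftrightarrow> adj (fst C) x y"
      if "x \<in> verts (fst C)" "y \<in> verts (fst C)" for x y
      using iso' that by (simp add: graph_iso_def)
  qed (use pr r bij_betw_apply[OF b] bij_betw_apply[OF b'] in auto)
qed

lemma bundle_equiv_sym: "bundle_equiv B C \<Longrightarrow> bundle_equiv C B"
proof (erule bundle_equivE)
  fix \<Phi> \<Psi>
  assume "\<And>x. x \<in> verts (fst B) \<Longrightarrow> \<Phi> x \<in> verts (fst C)"
    "\<And>x. x \<in> verts (fst B) \<Longrightarrow> \<Psi> (\<Phi> x) = x"
    "\<And>y. y \<in> verts (fst C) \<Longrightarrow> \<Psi> y \<in> verts (fst B)"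
    "\<And>y. y \<in> verts (fst C) \<Longrightarrow> \<Phi> (\<Psi> y) = y"
    "\<And>y. y \<in> verts (fst C) \<Longrightarrow> snd B (\<Psi> y) = snd C y"
    "\<And>x y. x \<in> verts (fst C) \<Longrightarrow> y \<in> verts (fst C) \<Longrightarrow>
      adj (fst B) (\<Psi> x) (\<Psi> y) \<longleftrightarrow> adj (fst C) x y"
  then show "bundle_equiv C B"
    by (intro bundle_equivI[where \<Phi> = \<Psi> and \<Psi> = \<Phi>]) simp_all
qed

lemma bundle_equiv_trans:
  assumes "bundle_equiv A B" "bundle_equiv B C"
  shows "bundle_equiv A C"
proof -
  obtain \<Phi> where 1: "graph_iso (fst A) (fst B) \<Phi>" "\<And>x. x \<in> verts (fst A) \<Longrightarrow> snd B (\<Phi> x) = snd A x"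
    using assms(1) by (auto simp: bundle_equiv_def split: prod.splits)
  obtain \<Psi> where 2: "graph_iso (fst B) (fst C) \<Psi>" "\<And>x. x \<in> verts (fst B) \<Longrightarrow> snd C (\<Psi> x) = snd B x"
    using assms(2) by (auto simp: bundle_equiv_def split: prod.splits)
  have "\<Phi> x \<in> verts (fst B)" if "x \<in> verts (fst A)" for x
    using 1(1) that bij_betw_apply by (fastforce simp: graph_iso_def)
  then have "snd C ((\<Psi> \<circ> \<Phi>) x) = snd A x" if "x \<in> verts (fst A)" for x
    using that 1(2) 2(2) by simp
  then show ?thesis
    using graph_iso_trans[OF 1(1) 2(1)]
    by (auto simp: bundle_equiv_def split: prod.splits)
qed

lemma bundle_equiv_subdirect:
  assumes "bundle_equiv B B'" "bundle_equiv C C'"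
  shows "bundle_equiv (subdirect G B C) (subdirect G B' C')"
proof -
  obtain \<Phi> \<Phi>' where P: "\<And>x. x \<in> verts (fst B) \<Longrightarrow> \<Phi> x \<in> verts (fst B')"
    "\<And>x. x \<in> verts (fst B) \<Longrightarrow> \<Phi>' (\<Phi> x) = x"
    "\<And>x. x \<in> verts (fst B) \<Longrightarrow> snd B' (\<Phi> x) = snd B x"
    "\<And>y. y \<in> verts (fst B') \<Longrightarrow> \<Phi>' y \<in> verts (fst B)"
    "\<And>y. y \<in> verts (fst B') \<Longrightarrow> \<Phi> (\<Phi>' y) = y"
    "\<And>y. y \<in> verts (fst B') \<Longrightarrow> snd B (\<Phi>' y) = snd B' y"
    "\<And>x y. x \<in> verts (fst B) \<Longrightarrow> y \<in> verts (fst B) \<Longrightarrow>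
      adj (fst B') (\<Phi> x) (\<Phi> y) \<longleftrightarrow> adj (fst B) x y"
    by (rule bundle_equivE[OF assms(1)]) blast
  obtain \<Psi> \<Psi>' where Q: "\<And>x. x \<in> verts (fst C) \<Longrightarrow> \<Psi> x \<in> verts (fst C')"
    "\<And>x. x \<in> verts (fst C) \<Longrightarrow> \<Psi>' (\<Psi> x) = x"
    "\<And>x. x \<in> verts (fst C) \<Longrightarrow> snd C' (\<Psi> x) = snd C x"
    "\<And>y. y \<in> verts (fst C') \<Longrightarrow> \<Psi>' y \<in> verts (fst C)"
    "\<And>y. y \<in> verts (fst C') \<Longrightarrow> \<Psi> (\<Psi>' y) = y"
    "\<And>y. y \<in> verts (fst C') \<Longrightarrow> snd C (\<Psi>' y) = snd C' y"
    "\<And>x y. x \<in> verts (fst C) \<Longrightarrow> y \<in> verts (fst C) \<Longrightarrow>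
      adj (fst C') (\<Psi> x) (\<Psi> y) \<longleftrightarrow> adj (fst C) x y"
    by (rule bundle_equivE[OF assms(2)]) blast
  \<comment> \<open>Clauses (I) and (II) contain equations between vertices, and these transfer
    along the equivalences only by injectivity.\<close>
  have inj: "\<Phi> x = \<Phi> y \<longleftrightarrow> x = y" if "x \<in> verts (fst B)" "y \<in> verts (fst B)" for x y
    using P(2) that by metis
  have inj': "\<Psi> x = \<Psi> y \<longleftrightarrow> x = y" if "x \<in> verts (fst C)" "y \<in> verts (fst C)" for x y
    using Q(2) that by metis
  show ?thesis
  proof (rule bundle_equivI[where \<Phi> = "map_prod \<Phi> \<Psi>" and \<Psi> = "map_prod \<Phi>' \<Psi>'"])
    fix a b assume "a \<in> verts (fst (subdirect G B C))" "b \<in> verts (fst (subdirect G B C))"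
    then show "adj (fst (subdirect G B C)) a b \<longleftrightarrow>
        adj (fst (subdirect G B' C')) (map_prod \<Phi> \<Psi> a) (map_prod \<Phi> \<Psi> b)"
      by (cases a; cases b)
        (simp add: verts_subdirect adj_subdirect P(1,3,7) Q(1,3,7) inj inj')
  qed (auto simp: verts_subdirect snd_subdirect P Q)
qed

lemma bundle_equiv_pullback:
  assumes "bundle_equiv B B'"
  shows "bundle_equiv (pullback G H f B) (pullback G H f B')"
proof -
  obtain \<Phi> \<Phi>' where P: "\<And>x. x \<in> verts (fst B) \<Longrightarrow> \<Phi> x \<in> verts (fst B')"
    "\<And>x. x \<in> verts (fst B) \<Longrightarrow> \<Phi>' (\<Phi> x) = x"
    "\<And>x. x \<in> verts (fst B) \<Longrightarrow> snd B' (\<Phi> x) = snd B x"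
    "\<And>y. y \<in> verts (fst B') \<Longrightarrow> \<Phi>' y \<in> verts (fst B)"
    "\<And>y. y \<in> verts (fst B') \<Longrightarrow> \<Phi> (\<Phi>' y) = y"
    "\<And>y. y \<in> verts (fst B') \<Longrightarrow> snd B (\<Phi>' y) = snd B' y"
    "\<And>x y. x \<in> verts (fst B) \<Longrightarrow> y \<in> verts (fst B) \<Longrightarrow>
      adj (fst B') (\<Phi> x) (\<Phi> y) \<longleftrightarrow> adj (fst B) x y"
    by (rule bundle_equivE[OF assms(1)]) blast
  have inj: "\<Phi> x = \<Phi> y \<longleftrightarrow> x = y" if "x \<in> verts (fst B)" "y \<in> verts (fst B)" for x y
    using P(2) that by metis
  show ?thesis
  proof (rule bundle_equivI[where \<Phi> = "map_prod id \<Phi>" and \<Psi> = "map_prod id \<Phi>'"])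
    fix a b assume "a \<in> verts (fst (pullback G H f B))" "b \<in> verts (fst (pullback G H f B))"
    then show "adj (fst (pullback G H f B)) a b \<longleftrightarrow>
        adj (fst (pullback G H f B')) (map_prod id \<Phi> a) (map_prod id \<Phi> b)"
      by (cases a; cases b) (simp add: verts_pullback adj_pullback P(1,3,7) inj)
  qed (auto simp: verts_pullback snd_pullback P)
qed

section \<open>Canonical equivalences between products and pullbacks\<close>

lemma subdirect_assoc:
  assumes "simple_graph G"
  shows "bundle_equiv (subdirect G (subdirect G B C) D) (subdirect G B (subdirect G C D))"
proof (rule bundle_equivI[where \<Phi> = "\<lambda>((x, y), z). (x, (y, z))"
      and \<Psi> = "\<lambda>(x, (y, z)). ((x, y), z)"])
  fix a b
  assume ab: "a \<in> verts (fst (subdirect G (subdirect G B C) D))"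
    "b \<in> verts (fst (subdirect G (subdirect G B C) D))"
  obtain x y z x' y' z' where [simp]: "a = ((x, y), z)" "b = ((x', y'), z')"
    by (cases a; cases b; cases "fst a"; cases "fst b") auto
  have irr: "\<not> adj G v v" for v using adj_verts(3)[OF assms] by blast
  have V: "x \<in> verts (fst B)" "x' \<in> verts (fst B)" "y \<in> verts (fst C)" "y' \<in> verts (fst C)"
    "z \<in> verts (fst D)" "z' \<in> verts (fst D)"
    "snd B x = snd D z" "snd B x' = snd D z'" "snd C y = snd D z" "snd C y' = snd D z'"
    using ab by (auto simp: verts_subdirect snd_subdirect)
  \<comment> \<open>Over one base point an edge moves exactly one of the three coordinates, in
    either bracketing; over an edge of \<open>G\<close> all three move. Comparing the base points
    separates the two situations.\<close>
  show "adj (fst (subdirect G (subdirect G B C) D)) a b \<longleftrightarrow>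
    adj (fst (subdirect G B (subdirect G C D)))
      ((\<lambda>((x, y), z). (x, (y, z))) a) ((\<lambda>((x, y), z). (x, (y, z))) b)"
  proof (cases "snd D z = snd D z'")
    case True
    then show ?thesis using V irr
      by (auto simp: adj_subdirect verts_subdirect snd_subdirect)
  next
    case False
    then show ?thesis using V
      by (auto simp: adj_subdirect verts_subdirect snd_subdirect)
  qed
qed (auto simp: verts_subdirect snd_subdirect)

lemma subdirect_comm: "bundle_equiv (subdirect G B C) (subdirect G C B)"
proof (rule bundle_equivI[where \<Phi> = prod.swap and \<Psi> = prod.swap])
  fix a b
  assume "a \<in> verts (fst (subdirect G B C))" "b \<in> verts (fst (subdirect G B C))"
  then show "adj (fst (subdirect G B C)) a b \<longleftrightarrow>
      adj (fst (subdirect G C B)) (prod.swap a) (prod.swap b)"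
    by (cases a; cases b) (auto simp: adj_subdirect verts_subdirect)
qed (auto simp: verts_subdirect snd_subdirect)

text \<open>The first coordinate is the projection of the second. As this projection is a morphism,
  an edge of \<open>B\<close> either stays in a fibre, which is clause (I), or lies over an edge of
  \<open>G\<close>, which is clause (III).\<close>

lemma subdirect_id:
  assumes G: "simple_graph G" and B: "graph_bundle F (fst B) (snd B) G"
  shows "bundle_equiv (subdirect G (G, id) B) B"
proof (rule bundle_equivI[where \<Phi> = snd and \<Psi> = "\<lambda>x. (snd B x, x)"])
  fix a b
  assume ab: "a \<in> verts (fst (subdirect G (G, id) B))" "b \<in> verts (fst (subdirect G (G, id) B))"
  obtain v x w y where [simp]: "a = (v, x)" "b = (w, y)" by (cases a; cases b)
  have "adj G v w \<or> v = w" if "adj (fst B) x y"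
    using ab graph_bundle_adj[OF B that] by (auto simp: verts_subdirect)
  moreover have "\<not> adj G v v" using adj_verts(3)[OF G] by blast
  ultimately show "adj (fst (subdirect G (G, id) B)) a b \<longleftrightarrow> adj (fst B) (snd a) (snd b)"
    using ab by (auto simp: adj_subdirect verts_subdirect)
qed (use graph_bundle_verts[OF B] in \<open>auto simp: verts_subdirect snd_subdirect\<close>)

lemma pullback_subdirect:
  assumes G: "simple_graph G" and H: "simple_graph H"
  shows "bundle_equiv (pullback G H f (subdirect H B C))
    (subdirect G (pullback G H f B) (pullback G H f C))"
proof (rule bundle_equivI[where \<Phi> = "\<lambda>(v, x, y). ((v, x), (v, y))"
      and \<Psi> = "\<lambda>((v, x), (w, y)). (v, x, y)"])
  fix a b
  assume ab: "a \<in> verts (fst (pullback G H f (subdirect H B C)))"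
    "b \<in> verts (fst (pullback G H f (subdirect H B C)))"
  obtain v x y v' x' y' where [simp]: "a = (v, x, y)" "b = (v', x', y')"
    by (cases a; cases b)
  have irrG: "\<not> adj G v v" for v using adj_verts(3)[OF G] by blast
  have irrH: "\<not> adj H v v" for v using adj_verts(3)[OF H] by blast
  have V: "v \<in> verts G" "v' \<in> verts G" "x \<in> verts (fst B)" "x' \<in> verts (fst B)"
    "y \<in> verts (fst C)" "y' \<in> verts (fst C)"
    "snd B x = f v" "snd B x' = f v'" "snd C y = f v" "snd C y' = f v'"
    using ab by (auto simp: verts_pullback verts_subdirect snd_subdirect)
  note simps = adj_pullback adj_subdirect verts_pullback verts_subdirect
    snd_subdirect snd_pullback
  \<comment> \<open>There are three cases: within a fibre the clauses for vertical edges agree; over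
    a collapsed edge both sides keep \<open>x\<close> and \<open>y\<close>; over an edge that
    survives in \<open>H\<close> both coordinates move along lifts.\<close>
  show "adj (fst (pullback G H f (subdirect H B C))) a b \<longleftrightarrow>
    adj (fst (subdirect G (pullback G H f B) (pullback G H f C)))
      (case a of (v, x, y) \<Rightarrow> ((v, x), (v, y))) (case b of (v, x, y) \<Rightarrow> ((v, x), (v, y)))"
  proof (cases "v = v'")
    case True
    then show ?thesis using V irrG irrH by (auto simp: simps)
  next
    case ne: False
    show ?thesis
    proof (cases "f v = f v'")
      case True
      then show ?thesis using V irrH ne by (auto simp: simps)
    next
      case False
      then show ?thesis using V ne by (auto simp: simps)
    qed
  qed
qed (auto simp: verts_pullback verts_subdirect snd_subdirect snd_pullback)

lemma pullback_comp:
  assumes H: "simple_graph H" and K: "simple_graph K"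
    and g: "graph_morphism G H g"
  shows "bundle_equiv (pullback G K (f \<circ> g) B) (pullback G H g (pullback H K f B))"
proof (rule bundle_equivI[where \<Phi> = "\<lambda>(v, x). (v, g v, x)" and \<Psi> = "\<lambda>(v, w, x). (v, x)"])
  fix a b
  assume ab: "a \<in> verts (fst (pullback G K (f \<circ> g) B))" "b \<in> verts (fst (pullback G K (f \<circ> g) B))"
  obtain v x v' x' where [simp]: "a = (v, x)" "b = (v', x')" by (cases a; cases b)
  have irr: "\<not> adj H v v" for v using adj_verts(3)[OF H] by blast
  have irrK: "\<not> adj K v v" for v using adj_verts(3)[OF K] by blast
  have gV: "g v \<in> verts H" if "v \<in> verts G" for v
    using g that by (auto simp: graph_morphism_def)
  have V: "v \<in> verts G" "v' \<in> verts G" "x \<in> verts (fst B)" "x' \<in> verts (fst B)"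
    "snd B x = f (g v)" "snd B x' = f (g v')" "g v \<in> verts H" "g v' \<in> verts H"
    using ab gV by (auto simp: verts_pullback)
  have gadj: "adj H (g v) (g v') \<or> g v = g v'" if "adj G v v'"
    using g that by (simp add: graph_morphism_def)
  \<comment> \<open>If \<open>g v = g v'\<close>, an edge is vertical or is collapsed by
    \<open>g\<close> and hence by \<open>f \<circ> g\<close>, which keeps \<open>x\<close> on both
    sides. Otherwise \<open>g\<close> maps an edge of \<open>G\<close> to an edge of
    \<open>H\<close>, and \<open>f\<close> collapses or lifts it alike on both sides.\<close>
  show "adj (fst (pullback G K (f \<circ> g) B)) a b \<longleftrightarrow>
    adj (fst (pullback G H g (pullback H K f B)))
      (case a of (v, x) \<Rightarrow> (v, g v, x)) (case b of (v, x) \<Rightarrow> (v, g v, x))"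
  proof (cases "g v = g v'")
    case True
    then show ?thesis
      using V irr irrK by (auto simp: adj_pullback verts_pullback snd_pullback)
  next
    case False
    then show ?thesis
      using V gadj by (auto simp: adj_pullback verts_pullback snd_pullback)
  qed
qed (use g in \<open>auto simp: verts_pullback snd_pullback graph_morphism_def image_subset_iff\<close>)

text \<open>The identity collapses no edge of a graph without loops, so the additional edges of the
  pullback do not occur, and the first coordinate is again determined by the second.\<close>

lemma pullback_id:
  assumes G: "simple_graph G" and B: "graph_bundle F (fst B) (snd B) G"
  shows "bundle_equiv (pullback G G id B) B"
proof (rule bundle_equivI[where \<Phi> = snd and \<Psi> = "\<lambda>x. (snd B x, x)"])
  fix a b
  assume ab: "a \<in> verts (fst (pullback G G id B))" "b \<in> verts (fst (pullback G G id B))"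
  obtain v x w y where [simp]: "a = (v, x)" "b = (w, y)" by (cases a; cases b)
  have "adj G v w \<or> v = w" if "adj (fst B) x y"
    using ab graph_bundle_adj[OF B that] by (auto simp: verts_pullback)
  moreover have "\<not> adj G v v" for v using adj_verts(3)[OF G] by blast
  ultimately show "adj (fst (pullback G G id B)) a b \<longleftrightarrow> adj (fst B) (snd a) (snd b)"
    using ab by (auto simp: adj_pullback verts_pullback)
qed (use graph_bundle_verts[OF B] in \<open>auto simp: verts_pullback snd_pullback\<close>)

section \<open>The monoid of bundle classes\<close>

text \<open>Extends membership in \<open>bundles\<close> to total spaces of arbitrary type, which is
  where subdirect products and pullbacks of members of \<open>bundles\<close> live.\<close>

definition power_bundle :: "'v ugraph \<Rightarrow> 'f ugraph \<Rightarrow> 'a ugraph \<times> ('a \<Rightarrow> 'v) \<Rightarrow> bool" where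
  "power_bundle G F B \<longleftrightarrow> (\<exists>n. graph_bundle (cart_power F n) (fst B) (snd B) G)"

lemma power_bundle_id: "simple_graph G \<Longrightarrow> power_bundle G F (G, id)"
  unfolding power_bundle_def fst_conv snd_conv by (rule exI) (rule graph_bundle_id)

lemma power_bundle_subdirect:
  assumes F: "simple_graph F" and G: "simple_graph G"
    and B: "power_bundle G F B" and C: "power_bundle G F C"
  shows "power_bundle G F (subdirect G B C)"
proof -
  obtain m n where "graph_bundle (cart_power F m) (fst B) (snd B) G"
    "graph_bundle (cart_power F n) (fst C) (snd C) G"
    using B C by (auto simp: power_bundle_def)
  from graph_bundle_subdirect[OF G this]
  have "graph_bundle (cart_power F (m + n)) (fst (subdirect G B C)) (snd (subdirect G B C)) G"
    using graph_bundle_fiber_iso graph_iso_cart_power_add[OF F] by fastforce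
  then show ?thesis by (auto simp: power_bundle_def)
qed

lemma power_bundle_pullback:
  assumes "simple_graph G" "simple_graph H" "graph_morphism G H f" "power_bundle H F B"
  shows "power_bundle G F (pullback G H f B)"
  using assms graph_bundle_pullback[OF assms(1-3), where p = "snd B" and X = "fst B"]
  unfolding power_bundle_def by auto

lemma bundles_iff: "B \<in> bundles G F \<longleftrightarrow> power_bundle G F B"
  by (cases B) (simp add: bundles_def power_bundle_def)

lemma bundle_class_eq:
  fixes G :: "'v ugraph" and F :: "'f ugraph"
  assumes "bundle_equiv B C"
  shows "bundle_class G F B = bundle_class G F C"
proof -
  have "bundle_equiv B D \<longleftrightarrow> bundle_equiv C D" 
    for D :: "('v \<times> 'f list) ugraph \<times> ('v \<times> 'f list \<Rightarrow> 'v)"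
    using bundle_equiv_trans[OF assms] bundle_equiv_trans[OF bundle_equiv_sym[OF assms]] by blast
  then show ?thesis unfolding bundle_class_def by simp
qed

lemma ex_power_bundle_representative:
  assumes "power_bundle G F B"
  shows "\<exists>C\<in>bundles G F. bundle_equiv B C"
  using assms ex_bundle_representative[of F _ "fst B" "snd B" G]
  by (auto simp: power_bundle_def)

text \<open>The counterpart of \<open>UN_groth_class\<close>. A bundle of foreign type is not itself
  a member of its class, so nonemptiness rests on the existence of a representative; an empty class
  would make the union empty.\<close>

lemma UN_bundle_class:
  assumes "power_bundle G F B" "\<And>C. bundle_equiv B C \<Longrightarrow> \<phi> C = c"
  shows "(\<Union>C\<in>bundle_class G F B. \<phi> C) = c"
proof -
  have "bundle_class G F B \<noteq> {}"
    using ex_power_bundle_representative[OF assms(1)] by (auto simp: bundle_class_def)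
  then show ?thesis by (rule SUP_eq_const) (auto simp: bundle_class_def assms(2))
qed

text \<open>The carrier is formed from bundles of the fixed type only; a bundle of another type has
  the same class as any representative of it.\<close>

lemma bundle_class_in_carrier:
  assumes "power_bundle G F B"
  shows "bundle_class G F B \<in> carrier (bundle_monoid G F)"
proof -
  obtain C where "C \<in> bundles G F" "bundle_equiv B C"
    using ex_power_bundle_representative[OF assms] by blast
  with bundle_class_eq[OF this(2), of G F] show ?thesis by (simp add: bundle_monoid_def)
qed

lemma bundle_monoid_cases:
  fixes G :: "'v ugraph" and F :: "'f ugraph"
  assumes "c \<in> carrier (bundle_monoid G F)"
  obtains B :: "('v \<times> 'f list) ugraph \<times> ('v \<times> 'f list \<Rightarrow> 'v)"
    where "power_bundle G F B" "c = bundle_class G F B"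
proof -
  have "c \<in> bundle_class G F ` bundles G F" using assms by (simp add: bundle_monoid_def)
  then show thesis using that bundles_iff by blast
qed

lemma mult_bundle_class:
  assumes "power_bundle G F B" "power_bundle G F C"
  shows "bundle_class G F B \<otimes>\<^bsub>bundle_monoid G F\<^esub> bundle_class G F C =
    bundle_class G F (subdirect G B C)"
proof -
  have "(\<Union>B'\<in>bundle_class G F B. \<Union>C'\<in>bundle_class G F C. bundle_class G F (subdirect G B' C')) =
    bundle_class G F (subdirect G B C)"
    using assms
    by (intro UN_bundle_class bundle_class_eq bundle_equiv_subdirect) (auto intro: bundle_equiv_sym)
  then show ?thesis by (simp add: bundle_monoid_def)
qed

lemma one_bundle_monoid: "\<one>\<^bsub>bundle_monoid G F\<^esub> = bundle_class G F (G, id)"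
  by (simp add: bundle_monoid_def)

lemma comm_monoid_bundle_monoid:
  fixes F :: "'f ugraph" and G :: "'v ugraph"
  assumes F: "simple_graph F" and G: "simple_graph G"
  shows "comm_monoid (bundle_monoid G F)"
proof (rule comm_monoidI)
  note S = power_bundle_subdirect[OF F G]
  show "x \<otimes>\<^bsub>bundle_monoid G F\<^esub> y \<in> carrier (bundle_monoid G F)"
    if "x \<in> carrier (bundle_monoid G F)" "y \<in> carrier (bundle_monoid G F)" for x y
    using that by (elim bundle_monoid_cases, simp add: mult_bundle_class S bundle_class_in_carrier)
  show "\<one>\<^bsub>bundle_monoid G F\<^esub> \<in> carrier (bundle_monoid G F)"
    by (simp add: one_bundle_monoid bundle_class_in_carrier power_bundle_id[OF G])
  show "x \<otimes>\<^bsub>bundle_monoid G F\<^esub> y \<otimes>\<^bsub>bundle_monoid G F\<^esub> z =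
      x \<otimes>\<^bsub>bundle_monoid G F\<^esub> (y \<otimes>\<^bsub>bundle_monoid G F\<^esub> z)"
    if "x \<in> carrier (bundle_monoid G F)" "y \<in> carrier (bundle_monoid G F)"
      "z \<in> carrier (bundle_monoid G F)" for x y z
    using that
    by (elim bundle_monoid_cases,
      simp add: mult_bundle_class S bundle_class_eq[OF subdirect_assoc[OF G]])
  show "x \<otimes>\<^bsub>bundle_monoid G F\<^esub> y = y \<otimes>\<^bsub>bundle_monoid G F\<^esub> x"
    if x: "x \<in> carrier (bundle_monoid G F)" and y: "y \<in> carrier (bundle_monoid G F)" for x y
  proof -
    obtain B :: "('v \<times> 'f list) ugraph \<times> ('v \<times> 'f list \<Rightarrow> 'v)"
      where B: "power_bundle G F B" "x = bundle_class G F B"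
      using x by (rule bundle_monoid_cases)
    obtain C :: "('v \<times> 'f list) ugraph \<times> ('v \<times> 'f list \<Rightarrow> 'v)"
      where C: "power_bundle G F C" "y = bundle_class G F C"
      using y by (rule bundle_monoid_cases)
    have "bundle_class G F (subdirect G B C) = bundle_class G F (subdirect G C B)"
      by (rule bundle_class_eq[OF subdirect_comm])
    then show ?thesis using B C by (simp only: mult_bundle_class)
  qed
  show "\<one>\<^bsub>bundle_monoid G F\<^esub> \<otimes>\<^bsub>bundle_monoid G F\<^esub> x = x"
    if x: "x \<in> carrier (bundle_monoid G F)" for x
  proof -
    obtain B :: "('v \<times> 'f list) ugraph \<times> ('v \<times> 'f list \<Rightarrow> 'v)"
      where B: "power_bundle G F B" "x = bundle_class G F B"
      using x by (rule bundle_monoid_cases)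
    then obtain n where "graph_bundle (cart_power F n) (fst B) (snd B) G"
      by (auto simp: power_bundle_def)
    then show ?thesis
      using B bundle_class_eq[OF subdirect_id[OF G]]
      by (simp add: one_bundle_monoid mult_bundle_class power_bundle_id[OF G])
  qed
qed

section \<open>Pullback as a homomorphism of monoids\<close>

lemma pullback_class_bundle_class:
  assumes "power_bundle H F B"
  shows "pullback_class F G H f (bundle_class H F B) = bundle_class G F (pullback G H f B)"
  unfolding pullback_class_def
  using assms
  by (intro UN_bundle_class bundle_class_eq bundle_equiv_pullback) (auto intro: bundle_equiv_sym)

lemma pullback_class_hom:
  assumes F: "simple_graph F" and G: "simple_graph G" and H: "simple_graph H"
    and f: "graph_morphism G H f"
  shows "pullback_class F G H f \<in> hom (bundle_monoid H F) (bundle_monoid G F)"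
proof (rule homI)
  note P = power_bundle_pullback[OF G H f]
  show "pullback_class F G H f x \<in> carrier (bundle_monoid G F)"
    if "x \<in> carrier (bundle_monoid H F)" for x
    using that
    by (elim bundle_monoid_cases, simp add: pullback_class_bundle_class P bundle_class_in_carrier)
  show "pullback_class F G H f (x \<otimes>\<^bsub>bundle_monoid H F\<^esub> y) =
      pullback_class F G H f x \<otimes>\<^bsub>bundle_monoid G F\<^esub> pullback_class F G H f y"
    if "x \<in> carrier (bundle_monoid H F)" "y \<in> carrier (bundle_monoid H F)" for x y
    using that
    by (elim bundle_monoid_cases,
      simp add: mult_bundle_class pullback_class_bundle_class P power_bundle_subdirect[OF F H]
        bundle_class_eq[OF pullback_subdirect[OF G H]])
qed

lemma pullback_class_comp:
  assumes G: "simple_graph G" and H: "simple_graph H" and K: "simple_graph K"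
    and g: "graph_morphism G H g" and f: "graph_morphism H K f"
    and c: "c \<in> carrier (bundle_monoid K F)"
  shows "pullback_class F G K (f \<circ> g) c = pullback_class F G H g (pullback_class F H K f c)"
  using c
  by (elim bundle_monoid_cases,
    simp add: pullback_class_bundle_class power_bundle_pullback[OF H K f]
      bundle_class_eq[OF pullback_comp[OF H K g]])

lemma pullback_class_id:
  fixes F :: "'f ugraph" and G :: "'v ugraph"
  assumes G: "simple_graph G" and c: "c \<in> carrier (bundle_monoid G F)"
  shows "pullback_class F G G id c = c"
proof -
  obtain B :: "('v \<times> 'f list) ugraph \<times> ('v \<times> 'f list \<Rightarrow> 'v)"
    where B: "power_bundle G F B" "c = bundle_class G F B"
    using c by (rule bundle_monoid_cases)
  then obtain n where "graph_bundle (cart_power F n) (fst B) (snd B) G"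
    by (auto simp: power_bundle_def)
  then show ?thesis
    using B bundle_class_eq[OF pullback_id[OF G]] by (simp add: pullback_class_bundle_class)
qed

section \<open>Functoriality\<close>

lemma K0_cases:
  assumes "simple_graph F" "simple_graph G" "\<xi> \<in> carrier (K0 G F)"
  obtains c d where "c \<in> carrier (bundle_monoid G F)" "d \<in> carrier (bundle_monoid G F)"
    "\<xi> = groth_class (bundle_monoid G F) c d"
  using assms comm_monoid.grothendieck_group_cases[OF comm_monoid_bundle_monoid]
  unfolding K0_def by metis

text \<open>\<open>K0_map\<close> is the map that \<open>pullback_class\<close> induces on group
  completions, so identities between such maps reduce to identities between pullbacks of
  classes.\<close>

lemma K0_map_groth_class:
  assumes "simple_graph F" "simple_graph G" "simple_graph H" "graph_morphism G H f"
    and "c \<in> carrier (bundle_monoid H F)" "d \<in> carrier (bundle_monoid H F)"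
  shows "K0_map F G H f (groth_class (bundle_monoid H F) c d) =
    groth_class (bundle_monoid G F) (pullback_class F G H f c) (pullback_class F G H f d)"
  unfolding K0_map_def
  using assms by (intro monoid_hom_groth_map comm_monoid_bundle_monoid pullback_class_hom)

lemma group_hom_K0_map:
  assumes "simple_graph F" "simple_graph G" "simple_graph H" "graph_morphism G H f"
  shows "group_hom (K0 H F) (K0 G F) (K0_map F G H f)"
  unfolding K0_def K0_map_def[abs_def]
  using assms by (intro group_hom_groth_map comm_monoid_bundle_monoid pullback_class_hom)

lemma K0_map_comp:
  assumes F: "simple_graph F" and G: "simple_graph G" and H: "simple_graph H" and K: "simple_graph K"
    and g: "graph_morphism G H g" and f: "graph_morphism H K f" and \<xi>: "\<xi> \<in> carrier (K0 K F)"
  shows "K0_map F G K (f \<circ> g) \<xi> = K0_map F G H g (K0_map F H K f \<xi>)"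
proof -
  obtain c d where cd: "c \<in> carrier (bundle_monoid K F)" "d \<in> carrier (bundle_monoid K F)"
    "\<xi> = groth_class (bundle_monoid K F) c d"
    using K0_cases[OF F K \<xi>] .
  have fg: "graph_morphism G K (f \<circ> g)"
    using g f by (fastforce simp: graph_morphism_def)
  \<comment> \<open>The outer map is evaluated on a pair of pulled back classes, which therefore
    have to lie in the monoid over \<open>H\<close>.\<close>
  have "pullback_class F H K f x \<in> carrier (bundle_monoid H F)"
    if "x \<in> carrier (bundle_monoid K F)" for x
    using pullback_class_hom[OF F H K f] that by (auto simp: hom_def)
  then show ?thesis
    using cd by (simp add: K0_map_groth_class F G H K f g fg pullback_class_comp[OF G H K g f])
qed

lemma K0_map_id:
  assumes F: "simple_graph F" and G: "simple_graph G" and \<xi>: "\<xi> \<in> carrier (K0 G F)"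
  shows "K0_map F G G id \<xi> = \<xi>"
proof -
  have "graph_morphism G G id" by (simp add: graph_morphism_def)
  then show ?thesis
    using K0_cases[OF F G \<xi>] K0_map_groth_class[OF F G G] pullback_class_id[OF G] by metis
qed

text \<open>Functions are total, so both functorial equations are asserted on the carriers, where
  \<open>K0_map\<close> has its meaning as a map of groups. The vertex types of the three graphs are
  independent of each other.\<close>

theorem corollary4p12:
  fixes F :: "'f ugraph"
  assumes "simple_graph F"
  shows
    "(\<forall>(\<Gamma>1 :: 'a ugraph) (\<Gamma>2 :: 'b ugraph) f.
        simple_graph \<Gamma>1 \<and> simple_graph \<Gamma>2 \<and> graph_morphism \<Gamma>1 \<Gamma>2 f \<longrightarrow>
        group_hom (K0 \<Gamma>2 F) (K0 \<Gamma>1 F) (K0_map F \<Gamma>1 \<Gamma>2 f)) \<and>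
     (\<forall>(\<Gamma>1 :: 'a ugraph) (\<Gamma>2 :: 'b ugraph) (\<Gamma>3 :: 'c ugraph) g f.
        simple_graph \<Gamma>1 \<and> simple_graph \<Gamma>2 \<and> simple_graph \<Gamma>3 \<and>
        graph_morphism \<Gamma>1 \<Gamma>2 g \<and> graph_morphism \<Gamma>2 \<Gamma>3 f \<longrightarrow>
        (\<forall>\<xi> \<in> carrier (K0 \<Gamma>3 F).
           K0_map F \<Gamma>1 \<Gamma>3 (f \<circ> g) \<xi> = K0_map F \<Gamma>1 \<Gamma>2 g (K0_map F \<Gamma>2 \<Gamma>3 f \<xi>))) \<and>
     (\<forall>\<Gamma> :: 'a ugraph.
        simple_graph \<Gamma> \<longrightarrow>
        (\<forall>\<xi> \<in> carrier (K0 \<Gamma> F). K0_map F \<Gamma> \<Gamma> id \<xi> = \<xi>))"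
proof (intro conjI allI impI ballI; (elim conjE)?)
  fix \<Gamma>1 :: "'a ugraph" and \<Gamma>2 :: "'b ugraph" and f
  assume "simple_graph \<Gamma>1" "simple_graph \<Gamma>2" "graph_morphism \<Gamma>1 \<Gamma>2 f"
  with assms show "group_hom (K0 \<Gamma>2 F) (K0 \<Gamma>1 F) (K0_map F \<Gamma>1 \<Gamma>2 f)"
    by (rule group_hom_K0_map)
next
  fix \<Gamma>1 :: "'a ugraph" and \<Gamma>2 :: "'b ugraph" and \<Gamma>3 :: "'c ugraph" and g f \<xi>
  assume "simple_graph \<Gamma>1" "simple_graph \<Gamma>2" "simple_graph \<Gamma>3"
    "graph_morphism \<Gamma>1 \<Gamma>2 g" "graph_morphism \<Gamma>2 \<Gamma>3 f" "\<xi> \<in> carrier (K0 \<Gamma>3 F)"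
  with assms show "K0_map F \<Gamma>1 \<Gamma>3 (f \<circ> g) \<xi> = K0_map F \<Gamma>1 \<Gamma>2 g (K0_map F \<Gamma>2 \<Gamma>3 f \<xi>)"
    by (rule K0_map_comp)
next
  fix \<Gamma> :: "'a ugraph" and \<xi>
  assume "simple_graph \<Gamma>" "\<xi> \<in> carrier (K0 \<Gamma> F)"
  with assms show "K0_map F \<Gamma> \<Gamma> id \<xi> = \<xi>" by (rule K0_map_id)
qed

end
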